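(* Let $\varepsilon>0$ with $\varepsilon^2\le\theta$, let $\hat\rho=2\bar\rho$, $\eta=\varepsilon^2$, and run the method ASGD-SIPP (described in the context) with inner iteration numbers $$T_k=\max\left\{2\sqrt{\frac{2(B+L/\eta+2\bar\rho)}{\bar\rho}},\ \frac{8\sigma^2}{\varepsilon^2}\right\}$$ (rounded up to integers). Then the total number of stochastic gradient computations required to obtain (in expectation) an $\varepsilon$-approximate stationary point of $\min_x\phi(x)$ is bounded by $$\mathcal{O}\left(\frac{\bar\rho\,[\phi(x^0)-\phi(x^\star)+R\eta]}{\varepsilon^2}\cdot\max\left\{\sqrt{\frac{B+L/\varepsilon^2+2\bar\rho}{\bar\rho}},\ \frac{\sigma^2}{\varepsilon^2}\right\}\right),$$ where $x^\star$ is a minimizer of $\phi$.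
   Context: Problem. $\phi=f+r$ on $\mathbb{R}^d$, where $f(x)=\mathbb{E}_\xi[f(x,\xi)]$ with each $f(\cdot,\xi):\mathbb{R}^d\to\mathbb{R}$ weakly convex, and $r:\mathbb{R}^d\to(-\infty,+\infty]$ is proper, convex, lower semicontinuous and bounded below. Let $\mathcal{X}\supseteq\operatorname{dom}r$ be closed and convex. Smoothed problem: minimize $\phi_\eta=f_\eta+r$, $f_\eta(x)=\mathbb{E}_\xi[f_\eta(x,\xi)]$, where $f_\eta$ is continuously differentiable and, for constants $\theta>0$, $\bar\rho>0$, $R,B,L\ge0$ and every $\eta\in(0,\theta]$: $f_\eta$ is $\bar\rho$-weakly convex (i.e. $f_\eta+\frac{\bar\rho}2\|\cdot\|^2$ is convex); $f_\eta\le f\le f_\eta+R\eta$ on $\mathcal{X}$; $\|\nabla f_\eta(x)-\nabla f_\eta(y)\|\le L_\eta\|x-y\|$ on $\mathcal{X}$ with $L_\eta=B+L/\eta$. Moreover $\nabla f_\eta(x)=\mathbb{E}_\xi[\nabla f_\eta(x,\xi)]$ and $\mathbb{E}_\xi\|\nabla f_\eta(x,\xi)-\nabla f_\eta(x)\|^2\le\sigma^2$ for $x\in\operatorname{dom}r$. $\phi$ and $\phi_\eta$ have minimizers. ASGD-SIPP. Start at $x^0\in\operatorname{dom}r$. For $k=1,2,\dots$ let $\hat\phi_k(x)=\phi_\eta(x)+\frac{\hat\rho}{2}\|x-x^{k-1}\|^2$, $\hat x^k=\arg\min\hat\phi_k$, and let $x^k$ be the output of $T_k$ iterations of the accelerated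 stochastic gradient method (a known method for smooth strongly convex stochastic composite problems, using one stochastic gradient $\nabla f_\eta(\cdot,\xi)$ per iteration) applied to $\min_x\hat\phi_k(x)$ from the starting point $x^{k-1}$. The known guarantee of this subroutine is $$\mathbb{E}_k[\hat\phi_k(x^k)-\hat\phi_k(\hat x^k)]\le\frac{2(L_\eta+\hat\rho)}{T_k(T_k+1)}\|x^{k-1}-\hat x^k\|^2+\frac{4\sigma^2}{(\hat\rho-\bar\rho)(T_k+1)},$$ where $\mathbb{E}_k$ is conditional expectation given $x^1,\dots,x^{k-1}$. Approximate stationarity. A point $x$ is an $\varepsilon$-approximate stationary point of $\min\phi$ if there is $\hat x\in\operatorname{dom}\phi$ with $\|\hat x-x\|\le\mathcal{O}(\varepsilon)$ and $\operatorname{dist}(0,\partial\phi(\hat x))\le\mathcal{O}(\varepsilon)$, where $\partial$ is the Fréchet (= limiting) subdifferential and the constants do not depend on $\varepsilon$. For the random iterates, "in expectation" means that for some $k$ among the outer iterations performed, there is a random $\hat x$ with $\mathbb{E}\|\hat x-x^k\|\le\mathcal{O}(\varepsilon)$ and $\mathbb{E}\operatorname{dist}(0,\partial\phi(\hat x))\le\mathcal{O}(\varepsilon)$. In the complexity bound $\mathcal{O}$ hides an absolute constant. *)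

theory Defs
  imports "HOL-Probability.Probability"
begin

section \<open>Extended-real-valued and weakly convex functions\<close>

definition domain_of :: "('a \<Rightarrow> ereal) \<Rightarrow> 'a set" where
  "domain_of h = {x. h x < \<infinity>}"

definition proper_fun :: "('a \<Rightarrow> ereal) \<Rightarrow> bool" where
  "proper_fun h \<longleftrightarrow> (\<forall>x. h x \<noteq> -\<infinity>) \<and> domain_of h \<noteq> {}"

definition convex_ereal :: "('a::real_vector \<Rightarrow> ereal) \<Rightarrow> bool" where
  "convex_ereal h \<longleftrightarrow> (\<forall>x y. \<forall>t\<in>{0..1::real}.
     h ((1 - t) *\<^sub>R x + t *\<^sub>R y) \<le> ereal (1 - t) * h x + ereal t * h y)"

definition lower_semicontinuous :: "('a::topological_space \<Rightarrow> ereal) \<Rightarrow> bool" where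
  "lower_semicontinuous h \<longleftrightarrow> (\<forall>x. h x \<le> Liminf (at x) h)"

definition weakly_convex :: "real \<Rightarrow> ('a::euclidean_space \<Rightarrow> real) \<Rightarrow> bool" where
  "weakly_convex \<rho> h \<longleftrightarrow> convex_on UNIV (\<lambda>x. h x + \<rho> / 2 * (norm x)\<^sup>2)"

definition minimizer :: "('a \<Rightarrow> ereal) \<Rightarrow> 'a \<Rightarrow> bool" where
  "minimizer h x \<longleftrightarrow> (\<forall>y. h x \<le> h y)"

definition gradient :: "('a::euclidean_space \<Rightarrow> real) \<Rightarrow> 'a \<Rightarrow> 'a" where
  "gradient h x = (THE D. GDERIV h x :> D)"

definition composite :: "('a \<Rightarrow> real) \<Rightarrow> ('a \<Rightarrow> ereal) \<Rightarrow> 'a \<Rightarrow> ereal" where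
  "composite f r x = ereal (f x) + r x"

definition frechet_subdiff :: "('a::euclidean_space \<Rightarrow> ereal) \<Rightarrow> 'a \<Rightarrow> 'a set" where
  "frechet_subdiff h x = {v. \<bar>h x\<bar> \<noteq> \<infinity> \<and>
     0 \<le> Liminf (at x) (\<lambda>y. (h y - h x - ereal (inner v (y - x))) / ereal (norm (y - x)))}"

text \<open>The distance from \<open>0\<close> to the subdifferential. It is \<open>\<infinity>\<close> when the subdifferential is empty;
  the library's real-valued \<^const>\<open>infdist\<close> and \<^const>\<open>setdist\<close> would give \<open>0\<close>.\<close>

definition subdiff_dist :: "('a::euclidean_space \<Rightarrow> ereal) \<Rightarrow> 'a \<Rightarrow> ennreal" where
  "subdiff_dist h x = (INF v\<in>frechet_subdiff h x. ennreal (norm v))"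

section \<open>The problem and its smoothing\<close>

definition mean_fun :: "'s measure \<Rightarrow> ('a \<Rightarrow> 's \<Rightarrow> real) \<Rightarrow> 'a \<Rightarrow> real" where
  "mean_fun P F x = (\<integral>s. F x s \<partial>P)"

text \<open>\<open>P\<close> is the law of the random datum \<open>\<xi>\<close>, \<open>F x s\<close> is \<open>f(x, s)\<close> and \<open>F\<^sub>s \<eta> x s\<close> is
  \<open>f\<^sub>\<eta>(x, s)\<close>; thus \<open>mean_fun P F\<close> is \<open>f\<close> and \<open>mean_fun P (F\<^sub>s \<eta>)\<close> is \<open>f\<^sub>\<eta>\<close>. The variance is a
  nonnegative integral, so the bound on it asserts that it is finite.\<close>

locale smoothed_problem = prob_space P
  for P :: "'s measure" +
  fixes F :: "'a::euclidean_space \<Rightarrow> 's \<Rightarrow> real"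
    and r :: "'a \<Rightarrow> ereal"
    and X :: "'a set"
    and F\<^sub>s :: "real \<Rightarrow> 'a \<Rightarrow> 's \<Rightarrow> real"
    and \<theta> \<rho> R B L \<sigma> :: real
  assumes F_integrable: "\<And>x. integrable P (F x)"
    and F_weakly_convex: "\<And>s. s \<in> space P \<Longrightarrow> \<exists>\<tau>\<ge>0. weakly_convex \<tau> (\<lambda>x. F x s)"
    and r_proper: "proper_fun r"
    and r_convex: "convex_ereal r"
    and r_lsc: "lower_semicontinuous r"
    and r_bounded_below: "\<exists>m::real. \<forall>x. ereal m \<le> r x"
    and X_closed: "closed X"
    and X_convex: "convex X"
    and dom_r_subset_X: "domain_of r \<subseteq> X"
    and constants: "0 < \<theta>" "0 < \<rho>" "0 \<le> R" "0 \<le> B" "0 \<le> L" "0 \<le> \<sigma>"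
    and Fs_integrable: "\<And>\<eta> x. \<lbrakk>0 < \<eta>; \<eta> \<le> \<theta>\<rbrakk> \<Longrightarrow> integrable P (F\<^sub>s \<eta> x)"
    and Fs_differentiable: "\<And>\<eta> x s. \<lbrakk>0 < \<eta>; \<eta> \<le> \<theta>; s \<in> space P\<rbrakk> \<Longrightarrow>
      (\<lambda>y. F\<^sub>s \<eta> y s) differentiable (at x)"
    and fs_differentiable: "\<And>\<eta> x. \<lbrakk>0 < \<eta>; \<eta> \<le> \<theta>\<rbrakk> \<Longrightarrow>
      mean_fun P (F\<^sub>s \<eta>) differentiable (at x)"
    and fs_gradient_continuous: "\<And>\<eta>. \<lbrakk>0 < \<eta>; \<eta> \<le> \<theta>\<rbrakk> \<Longrightarrow>
      continuous_on UNIV (gradient (mean_fun P (F\<^sub>s \<eta>)))"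
    and fs_weakly_convex: "\<And>\<eta>. \<lbrakk>0 < \<eta>; \<eta> \<le> \<theta>\<rbrakk> \<Longrightarrow> weakly_convex \<rho> (mean_fun P (F\<^sub>s \<eta>))"
    and fs_le_f: "\<And>\<eta> x. \<lbrakk>0 < \<eta>; \<eta> \<le> \<theta>; x \<in> X\<rbrakk> \<Longrightarrow> mean_fun P (F\<^sub>s \<eta>) x \<le> mean_fun P F x"
    and f_le_fs: "\<And>\<eta> x. \<lbrakk>0 < \<eta>; \<eta> \<le> \<theta>; x \<in> X\<rbrakk> \<Longrightarrow>
      mean_fun P F x \<le> mean_fun P (F\<^sub>s \<eta>) x + R * \<eta>"
    and fs_gradient_lipschitz: "\<And>\<eta> x y. \<lbrakk>0 < \<eta>; \<eta> \<le> \<theta>; x \<in> X; y \<in> X\<rbrakk> \<Longrightarrow>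
      norm (gradient (mean_fun P (F\<^sub>s \<eta>)) x - gradient (mean_fun P (F\<^sub>s \<eta>)) y)
        \<le> (B + L / \<eta>) * norm (x - y)"
    and stoch_gradient_integrable: "\<And>\<eta> x. \<lbrakk>0 < \<eta>; \<eta> \<le> \<theta>; x \<in> domain_of r\<rbrakk> \<Longrightarrow>
      integrable P (\<lambda>s. gradient (\<lambda>y. F\<^sub>s \<eta> y s) x)"
    and stoch_gradient_unbiased: "\<And>\<eta> x. \<lbrakk>0 < \<eta>; \<eta> \<le> \<theta>; x \<in> domain_of r\<rbrakk> \<Longrightarrow>
      gradient (mean_fun P (F\<^sub>s \<eta>)) x = (\<integral>s. gradient (\<lambda>y. F\<^sub>s \<eta> y s) x \<partial>P)"
    and stoch_gradient_variance: "\<And>\<eta> x. \<lbrakk>0 < \<eta>; \<eta> \<le> \<theta>; x \<in> domain_of r\<rbrakk> \<Longrightarrow>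
      (\<integral>\<^sup>+s. ennreal ((norm (gradient (\<lambda>y. F\<^sub>s \<eta> y s) x - gradient (mean_fun P (F\<^sub>s \<eta>)) x))\<^sup>2) \<partial>P)
        \<le> ennreal (\<sigma>\<^sup>2)"
    and minimizer_exists: "\<exists>x. minimizer (composite (mean_fun P F) r) x"
    and smoothed_minimizer_exists: "\<And>\<eta>. \<lbrakk>0 < \<eta>; \<eta> \<le> \<theta>\<rbrakk> \<Longrightarrow>
      \<exists>x. minimizer (composite (mean_fun P (F\<^sub>s \<eta>)) r) x"

section \<open>The method ASGD-SIPP\<close>

text \<open>\<open>prox_objective \<phi>\<^sub>\<eta> \<rho>h x\<^sup>k\<^sup>-\<^sup>1\<close> is the objective of the \<open>k\<close>-th subproblem, and
  \<open>prox_point \<phi>\<^sub>\<eta> \<rho>h x\<^sup>k\<^sup>-\<^sup>1\<close> is its exact solution.\<close>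

definition prox_objective :: "('a::euclidean_space \<Rightarrow> ereal) \<Rightarrow> real \<Rightarrow> 'a \<Rightarrow> 'a \<Rightarrow> ereal" where
  "prox_objective h \<kappa> c x = h x + ereal (\<kappa> / 2 * (norm (x - c))\<^sup>2)"

definition prox_point :: "('a::euclidean_space \<Rightarrow> ereal) \<Rightarrow> real \<Rightarrow> 'a \<Rightarrow> 'a" where
  "prox_point h \<kappa> c = arg_min (prox_objective h \<kappa> c) (\<lambda>_. True)"

text \<open>The stochastic gradients obtained in \<open>n\<close> iterations of a procedure that uses one of them per
  iteration: iteration \<open>t\<close> evaluates the stochastic gradient \<open>g\<close> at a point chosen by the rule
  \<open>q\<close> from the gradients seen so far, with the sample \<open>s t\<close>.\<close>

fun stoch_grads :: "('a \<Rightarrow> 's \<Rightarrow> 'a) \<Rightarrow> ('a list \<Rightarrow> 'a) \<Rightarrow> (nat \<Rightarrow> 's) \<Rightarrow> nat \<Rightarrow> 'a list" where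
  "stoch_grads g q s 0 = []"
| "stoch_grads g q s (Suc t) = stoch_grads g q s t @ [g (q (stoch_grads g q s t)) (s t)]"

lemma length_stoch_grads [simp]: "length (stoch_grads g q s n) = n"
  by (induction n) auto

text \<open>The sigma-algebra generated by \<open>x\<^sup>1, \<dots>, x\<^sup>k\<^sup>-\<^sup>1\<close>.\<close>

definition history :: "'w measure \<Rightarrow> (nat \<Rightarrow> 'w \<Rightarrow> 'a::euclidean_space) \<Rightarrow> nat \<Rightarrow> 'w measure" where
  "history M x k = vimage_algebra (space M) (\<lambda>\<omega>. \<lambda>i\<in>{1..<k}. x i \<omega>) (\<Pi>\<^sub>M i\<in>{1..<k}. borel)"

text \<open>The guarantee of the accelerated stochastic gradient subroutine for the \<open>k\<close>-th subproblem.
  The optimality gap is nonnegative and possibly infinite, so its conditional expectation is that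
  of a nonnegative function and no integrability has to be assumed.\<close>

definition subroutine_guarantee ::
  "'w measure \<Rightarrow> ('a::euclidean_space \<Rightarrow> ereal) \<Rightarrow> real \<Rightarrow> real \<Rightarrow> real \<Rightarrow> real \<Rightarrow>
    (nat \<Rightarrow> 'w \<Rightarrow> 'a) \<Rightarrow> nat \<Rightarrow> nat \<Rightarrow> bool" where
  "subroutine_guarantee M \<phi>\<^sub>\<eta> \<kappa> \<rho> L\<^sub>\<eta> \<sigma> x k T \<longleftrightarrow>
    (AE \<omega> in M.
      nn_cond_exp M (history M x k)
        (\<lambda>\<omega>. let c = x (k - 1) \<omega>
              in e2ennreal (prox_objective \<phi>\<^sub>\<eta> \<kappa> c (x k \<omega>)
                          - prox_objective \<phi>\<^sub>\<eta> \<kappa> c (prox_point \<phi>\<^sub>\<eta> \<kappa> c))) \<omega>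
      \<le> ennreal (2 * (L\<^sub>\<eta> + \<kappa>) / (real T * (real T + 1))
                    * (norm (x (k - 1) \<omega> - prox_point \<phi>\<^sub>\<eta> \<kappa> (x (k - 1) \<omega>)))\<^sup>2
                + 4 * \<sigma>\<^sup>2 / ((\<kappa> - \<rho>) * (real T + 1))))"

text \<open>A run of ASGD-SIPP with smoothing parameter \<open>\<eta>\<close>, proximal parameter \<open>\<kappa>\<close> (the
  \<open>\<rho>\<close> with a hat) and \<open>T k\<close> inner iterations in the \<open>k\<close>-th outer iteration, on a
  probability space \<open>M\<close>. The accelerated method enters through its query rule \<open>query k\<close> and its
  output rule \<open>out k\<close>, which see only the starting point and the stochastic gradients computed, and
  through its guarantee. \<open>\<xi> k t\<close> is the sample used in inner iteration \<open>t\<close> of outer iteration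
  \<open>k\<close>. As \<open>stoch_grads\<close> returns a list of length \<open>T k\<close>, outer iteration \<open>k\<close> costs
  \<open>T k\<close> stochastic gradient computations.\<close>

definition asgd_sipp_run ::
  "'s measure \<Rightarrow> ('a::euclidean_space \<Rightarrow> ereal) \<Rightarrow> (real \<Rightarrow> 'a \<Rightarrow> 's \<Rightarrow> real) \<Rightarrow>
    real \<Rightarrow> real \<Rightarrow> real \<Rightarrow> real \<Rightarrow> real \<Rightarrow> real \<Rightarrow> (nat \<Rightarrow> nat) \<Rightarrow> 'a \<Rightarrow>
    'w measure \<Rightarrow> (nat \<Rightarrow> nat \<Rightarrow> 'w \<Rightarrow> 's) \<Rightarrow>
    (nat \<Rightarrow> 'a \<Rightarrow> 'a list \<Rightarrow> 'a) \<Rightarrow> (nat \<Rightarrow> 'a \<Rightarrow> 'a list \<Rightarrow> 'a) \<Rightarrow>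
    (nat \<Rightarrow> 'w \<Rightarrow> 'a) \<Rightarrow> bool" where
  "asgd_sipp_run P r F\<^sub>s \<eta> \<kappa> \<rho> B L \<sigma> T x0 M \<xi> query out x \<longleftrightarrow>
     prob_space M \<and>
     (\<forall>k t. \<xi> k t \<in> measurable M P \<and> distr M P (\<xi> k t) = P) \<and>
     prob_space.indep_vars M (\<lambda>_. P) (\<lambda>(k, t). \<xi> k t) UNIV \<and>
     (\<forall>k. x k \<in> borel_measurable M) \<and>
     (\<forall>\<omega>\<in>space M. x 0 \<omega> = x0) \<and>
     (\<forall>k\<ge>1. \<forall>\<omega>\<in>space M.
        x k \<omega> = out k (x (k - 1) \<omega>)
          (stoch_grads (\<lambda>y s. gradient (\<lambda>z. F\<^sub>s \<eta> z s) y) (query k (x (k - 1) \<omega>))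
             (\<lambda>t. \<xi> k t \<omega>) (T k))) \<and>
     (\<forall>k\<ge>1. subroutine_guarantee M (composite (mean_fun P (F\<^sub>s \<eta>)) r) \<kappa> \<rho> (B + L / \<eta>) \<sigma> x k (T k))"

section \<open>Approximate stationarity in expectation\<close>

text \<open>Both tolerances are \<open>\<delta>\<close>. The measurability of the distance is demanded, because the
  nonnegative integral of a non-measurable function is not an expectation.\<close>

definition approx_stationary_in_expectation ::
  "'w measure \<Rightarrow> ('a::euclidean_space \<Rightarrow> ereal) \<Rightarrow> real \<Rightarrow> ('w \<Rightarrow> 'a) \<Rightarrow> bool" where
  "approx_stationary_in_expectation M \<phi> \<delta> z \<longleftrightarrow>
     (\<exists>xh \<in> borel_measurable M.
        (\<forall>\<omega>\<in>space M. xh \<omega> \<in> domain_of \<phi>) \<and>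
        (\<integral>\<^sup>+\<omega>. ennreal (norm (xh \<omega> - z \<omega>)) \<partial>M) \<le> ennreal \<delta> \<and>
        (\<lambda>\<omega>. subdiff_dist \<phi> (xh \<omega>)) \<in> borel_measurable M \<and>
        (\<integral>\<^sup>+\<omega>. subdiff_dist \<phi> (xh \<omega>) \<partial>M) \<le> ennreal \<delta>)"

end

theory Submission
  imports Defs
begin

text \<open>
  As \<open>\<phi>\<close> is the uniform limit of the \<open>\<phi>\<^sub>\<eta>\<close>, it is \<open>\<rho>\<close>-weakly convex and lower semicontinuous,
  although nothing uniform is assumed about \<open>F\<close>. The witness near \<open>x\<^sup>k\<close> is the exact proximal point
  of \<open>\<phi>\<close>, not of \<open>\<phi>\<^sub>\<eta>\<close>, at \<open>x\<^sup>k\<^sup>-\<^sup>1\<close>: its subdifferential contains \<open>2\<rho>\<close> times the proximal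
  displacement, and strong convexity of the subproblems puts it within \<open>sqrt (R\<eta>/\<rho>)\<close> of the
  proximal point of \<open>\<phi>\<^sub>\<eta>\<close>. The choice of \<open>T\<close> turns the guarantee of the subroutine into a bound by
  \<open>\<rho>/4\<close> times the squared displacement plus \<open>\<epsilon>\<^sup>2/(2\<rho>)\<close>, so \<open>\<phi>\<^sub>\<eta>\<close> decreases in expectation by a
  multiple of the squared displacement up to \<open>O(\<epsilon>\<^sup>2)\<close>. Telescoping over
  \<open>K = floor (\<rho>\<Delta>/\<epsilon>\<^sup>2)\<close> steps, where \<open>\<Delta> = \<phi>(x\<^sup>0) - \<phi>(x*) + R\<eta>\<close>, gives one step with expected squared
  displacement \<open>O(\<epsilon>\<^sup>2/\<rho>\<^sup>2)\<close>. If \<open>K = 0\<close>, then \<open>x\<^sup>0\<close> is so close to optimal that it is already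
  approximately stationary.
\<close>

section \<open>Elementary inequalities for limits and segments\<close>

text \<open>Letting \<open>t\<close> tend to 0 from the right removes the error term. Three limits
  go through it: the position along a segment, the slack in a liminf, and the smoothing
  parameter.\<close>

lemma le_if_le_linear_perturbation:
  fixes a b c s :: real
  assumes "0 < s" "\<And>t. \<lbrakk>0 < t; t \<le> s\<rbrakk> \<Longrightarrow> a \<le> b + t * c"
  shows "a \<le> b"
proof (rule tendsto_lowerbound)
  show "((\<lambda>t. b + t * c) \<longlongrightarrow> b) (at_right 0)"
    by (auto intro!: tendsto_eq_intros)
  have "\<forall>\<^sub>F t in at_right 0. 0 < t \<and> t < s"
    using eventually_at_right_real[OF assms(1)] by (auto elim: eventually_mono)
  then show "\<forall>\<^sub>F t in at_right 0. a \<le> b + t * c"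
    by eventually_elim (use assms(2) in auto)
qed simp

lemma norm_sq_convex_combination:
  fixes x y :: "'a::real_inner"
  shows "(norm ((1 - t) *\<^sub>R x + t *\<^sub>R y))\<^sup>2
    = (1 - t) * (norm x)\<^sup>2 + t * (norm y)\<^sup>2 - t * (1 - t) * (norm (x - y))\<^sup>2"
  by (simp add: power2_norm_eq_inner inner_commute algebra_simps)

section \<open>Proximal points and subgradients\<close>

text \<open>Values enter the inequalities only through real upper bounds, which keeps infinite values out of
  the arithmetic.\<close>

locale weakly_convex_lsc =
  fixes h :: "'a::euclidean_space \<Rightarrow> ereal" and \<rho> :: real
  assumes wconv: "\<And>x y a b t. \<lbrakk>h x \<le> ereal a; h y \<le> ereal b; 0 \<le> t; t \<le> 1\<rbrakk> \<Longrightarrow>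
      h ((1 - t) *\<^sub>R x + t *\<^sub>R y)
        \<le> ereal ((1 - t) * a + t * b + \<rho> / 2 * (t * (1 - t) * (norm (x - y))\<^sup>2))"
    and lsc: "\<And>xs x as a. \<lbrakk>xs \<longlonglongrightarrow> x; as \<longlonglongrightarrow> a; \<And>n. h (xs n) \<le> ereal (as n)\<rbrakk> \<Longrightarrow> h x \<le> ereal a"
    and attains_min: "\<exists>z m. h z = ereal m \<and> (\<forall>y. ereal m \<le> h y)"
begin

lemma not_MInf [simp]: "h x \<noteq> -\<infinity>"
  using attains_min by (metis MInfty_neq_ereal(1) ereal_infty_less_eq(2))

lemma finite_value:
  assumes "h x < \<infinity>" obtains a where "h x = ereal a"
  using assms by (cases "h x") auto

lemma borel_measurable_h [measurable]: "h \<in> borel_measurable borel"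
proof (rule borel_measurableI_le)
  fix y :: ereal
  consider "y = \<infinity>" | "y = -\<infinity>" | a where "y = ereal a" by (cases y) auto
  then show "{x \<in> space borel. h x \<le> y} \<in> sets borel"
  proof cases
    case (3 a)
    have "closed {x. h x \<le> ereal a}"
      unfolding closed_sequential_limits using lsc[OF _ tendsto_const] by blast
    then show ?thesis using 3 by simp
  qed auto
qed

text \<open>Direct method: \<open>h\<close> is bounded below, so the quadratic term keeps a
  minimizing sequence bounded; a convergent subsequence and lower semicontinuity give the
  minimizer.\<close>

lemma prox_objective_attains_min:
  assumes "0 < \<kappa>"
  shows "\<exists>p. \<forall>y. prox_objective h \<kappa> c p \<le> prox_objective h \<kappa> c y"
proof -
  obtain z m where z: "h z = ereal m" and m: "\<And>y. ereal m \<le> h y"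
    using attains_min by blast
  \<comment> \<open>\<open>S\<close> collects the real numbers that bound some objective value from
    above. With the quadratic term moved to the right, only \<open>h\<close> itself can be
    infinite.\<close>
  define S where "S = {a. \<exists>x. h x \<le> ereal (a - \<kappa> / 2 * (norm (x - c))\<^sup>2)}"
  define I where "I = Inf S"
  have S_lower: "m + \<kappa> / 2 * (norm (x - c))\<^sup>2 \<le> a"
    if "h x \<le> ereal (a - \<kappa> / 2 * (norm (x - c))\<^sup>2)" for a x
    using order_trans[OF m that] by simp
  have "m \<le> a" if "a \<in> S" for a
  proof -
    from that obtain x where "h x \<le> ereal (a - \<kappa> / 2 * (norm (x - c))\<^sup>2)"
      unfolding S_def by blast
    then have "m + \<kappa> / 2 * (norm (x - c))\<^sup>2 \<le> a" by (rule S_lower)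
    moreover have "0 \<le> \<kappa> / 2 * (norm (x - c))\<^sup>2" using \<open>0 < \<kappa>\<close> by simp
    ultimately show ?thesis by linarith
  qed
  then have bdd: "bdd_below S" by (rule bdd_belowI)
  have "m + \<kappa> / 2 * (norm (z - c))\<^sup>2 \<in> S"
    unfolding S_def using z by (auto intro!: exI[of _ z])
  then have nonempty: "S \<noteq> {}" by blast
  have "\<exists>x. h x \<le> ereal (I + 1 / real (Suc n) - \<kappa> / 2 * (norm (x - c))\<^sup>2)" for n
  proof -
    have "Inf S < I + 1 / real (Suc n)" unfolding I_def by simp
    then obtain a where "a \<in> S" "a < I + 1 / real (Suc n)"
      using cInf_less_iff[OF nonempty bdd] by blast
    then obtain x where "h x \<le> ereal (a - \<kappa> / 2 * (norm (x - c))\<^sup>2)"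
      unfolding S_def by blast
    also have "\<dots> \<le> ereal (I + 1 / real (Suc n) - \<kappa> / 2 * (norm (x - c))\<^sup>2)"
      using \<open>a < _\<close> by simp
    finally show ?thesis by blast
  qed
  then obtain xs where xs: "\<And>n. h (xs n) \<le> ereal (I + 1 / real (Suc n) - \<kappa> / 2 * (norm (xs n - c))\<^sup>2)"
    by metis
  \<comment> \<open>As \<open>h\<close> is at least \<open>m\<close>, the quadratic term is at most
    \<open>I + 1 - m\<close>; this gives the radius.\<close>
  have "xs n \<in> cball c (sqrt (2 * (I + 1 - m) / \<kappa>))" for n
  proof -
    have "1 / real (Suc n) \<le> 1" by simp
    with S_lower[OF xs[of n]] have "m + \<kappa> / 2 * (norm (xs n - c))\<^sup>2 \<le> I + 1" by linarith
    then have "(norm (xs n - c))\<^sup>2 \<le> 2 * (I + 1 - m) / \<kappa>"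
      using \<open>0 < \<kappa>\<close> by (simp add: field_simps)
    then show ?thesis
      by (simp add: dist_norm norm_minus_commute real_le_rsqrt)
  qed
  then obtain p q where q: "strict_mono q" and p: "(xs \<circ> q) \<longlonglongrightarrow> p"
    using compact_cball[of c] unfolding compact_def by metis
  have "h p \<le> ereal (I + 0 - \<kappa> / 2 * (norm (p - c))\<^sup>2)"
  proof (rule lsc[OF p])
    show "(\<lambda>n. I + 1 / real (Suc (q n)) - \<kappa> / 2 * (norm ((xs \<circ> q) n - c))\<^sup>2)
        \<longlonglongrightarrow> I + 0 - \<kappa> / 2 * (norm (p - c))\<^sup>2"
      using LIMSEQ_subseq_LIMSEQ[OF LIMSEQ_inverse_real_of_nat q]
      by (intro tendsto_intros p) (simp add: o_def inverse_eq_divide)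
  qed (use xs in simp)
  then have p_le: "prox_objective h \<kappa> c p \<le> ereal I"
    unfolding prox_objective_def by (cases "h p") auto
  have "ereal I \<le> prox_objective h \<kappa> c y" for y
  proof (cases "h y")
    case (real b)
    then have "b + \<kappa> / 2 * (norm (y - c))\<^sup>2 \<in> S" unfolding S_def by (auto intro!: exI[of _ y])
    then have "I \<le> b + \<kappa> / 2 * (norm (y - c))\<^sup>2" unfolding I_def by (rule cInf_lower[OF _ bdd])
    then show ?thesis by (simp add: prox_objective_def real)
  qed (auto simp: prox_objective_def)
  with p_le show ?thesis by (meson order_trans)
qed

text \<open>\<open>prox_point\<close> is a Hilbert choice through \<open>arg_min\<close>, so its
  minimality rests on the existence of a minimizer.\<close>

lemma prox_point_minimal:
  assumes "0 < \<kappa>"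
  shows "prox_objective h \<kappa> c (prox_point h \<kappa> c) \<le> prox_objective h \<kappa> c y"
proof -
  obtain p where "is_arg_min (prox_objective h \<kappa> c) (\<lambda>_. True) p"
    using prox_objective_attains_min[OF assms] by (auto simp: is_arg_min_def not_less)
  then have "is_arg_min (prox_objective h \<kappa> c) (\<lambda>_. True) (prox_point h \<kappa> c)"
    unfolding prox_point_def arg_min_def by (rule someI)
  then show ?thesis by (simp add: is_arg_min_def not_less)
qed

lemma prox_point_finite:
  assumes "0 < \<kappa>" obtains b where "h (prox_point h \<kappa> c) = ereal b"
proof -
  obtain z m where "h z = ereal m" using attains_min by blast
  then have "h (prox_point h \<kappa> c) \<noteq> \<infinity>"
    using prox_point_minimal[OF assms, of c z] by (auto simp: prox_objective_def)
  then show ?thesis using that finite_value by (metis ereal_infty_less(1))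
qed

text \<open>Quadratic growth of the subproblem around its minimizer, by comparison with points of
  the segment towards \<open>y\<close>. The squared norm contributes a convexity surplus with
  coefficient \<open>\<kappa> / 2 * t * (1 - t)\<close>, against the defect
  \<open>\<rho> / 2 * t * (1 - t)\<close> of \<open>h\<close>. Most later estimates are this
  inequality with a suitable \<open>y\<close>.\<close>

lemma prox_point_strong_minimal:
  assumes "0 < \<kappa>" "h (prox_point h \<kappa> c) = ereal b" "h y \<le> ereal a"
  shows "b + \<kappa> / 2 * (norm (prox_point h \<kappa> c - c))\<^sup>2 + (\<kappa> - \<rho>) / 2 * (norm (y - prox_point h \<kappa> c))\<^sup>2
    \<le> a + \<kappa> / 2 * (norm (y - c))\<^sup>2"
proof -
  define p where "p = prox_point h \<kappa> c"
  show ?thesis unfolding p_def[symmetric]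
  proof (rule le_if_le_linear_perturbation[of 1 _ _ "(\<kappa> - \<rho>) / 2 * (norm (y - p))\<^sup>2"])
    fix t :: real assume t: "0 < t" "t \<le> 1"
    define z where "z = (1 - t) *\<^sub>R p + t *\<^sub>R y"
    have z: "h z \<le> ereal ((1 - t) * b + t * a + \<rho> / 2 * (t * (1 - t) * (norm (p - y))\<^sup>2))"
      unfolding z_def using t assms(2,3) by (intro wconv) (auto simp: p_def)
    have "ereal (b + \<kappa> / 2 * (norm (p - c))\<^sup>2) = prox_objective h \<kappa> c p"
      using assms(2) by (simp add: prox_objective_def p_def)
    also have "\<dots> \<le> prox_objective h \<kappa> c z"
      unfolding p_def by (rule prox_point_minimal[OF assms(1)])
    also have "\<dots> \<le> ereal ((1 - t) * b + t * a + \<rho> / 2 * (t * (1 - t) * (norm (p - y))\<^sup>2)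
        + \<kappa> / 2 * (norm (z - c))\<^sup>2)"
      using z unfolding prox_objective_def by (cases "h z") auto
    finally have le: "b + \<kappa> / 2 * (norm (p - c))\<^sup>2 \<le> (1 - t) * b + t * a
        + \<rho> / 2 * (t * (1 - t) * (norm (p - y))\<^sup>2) + \<kappa> / 2 * (norm (z - c))\<^sup>2" by simp
    have "z - c = (1 - t) *\<^sub>R (p - c) + t *\<^sub>R (y - c)"
      unfolding z_def by (simp add: algebra_simps)
    then have zc: "(norm (z - c))\<^sup>2 = (1 - t) * (norm (p - c))\<^sup>2 + t * (norm (y - c))\<^sup>2
        - t * (1 - t) * (norm (p - y))\<^sup>2"
      using norm_sq_convex_combination[of t "p - c" "y - c"] by simp
    \<comment> \<open>All terms carry a factor \<open>t\<close>. Dividing it out leaves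
      \<open>1 - t\<close> on the growth term, and its \<open>t\<close>-part becomes the vanishing
      error.\<close>
    have "t * (b + \<kappa> / 2 * (norm (p - c))\<^sup>2 + (\<kappa> - \<rho>) / 2 * (norm (y - p))\<^sup>2)
        \<le> t * (a + \<kappa> / 2 * (norm (y - c))\<^sup>2 + t * ((\<kappa> - \<rho>) / 2 * (norm (y - p))\<^sup>2))"
      using le unfolding zc by (simp add: norm_minus_commute[of y p] field_simps)
    then show "b + \<kappa> / 2 * (norm (p - c))\<^sup>2 + (\<kappa> - \<rho>) / 2 * (norm (y - p))\<^sup>2
        \<le> a + \<kappa> / 2 * (norm (y - c))\<^sup>2 + t * ((\<kappa> - \<rho>) / 2 * (norm (y - p))\<^sup>2)"
      using t(1) by simp
  qed simp
qed

text \<open>Quadratic growth is applied at each proximal point with the other one as competitor. In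
  the sum the values of \<open>h\<close> cancel and the squared norms collapse to an inner product,
  which Cauchy-Schwarz bounds. The purpose is measurability of \<open>prox_point\<close> in its
  centre.\<close>

lemma prox_point_lipschitz:
  assumes "0 < \<kappa>" "\<rho> < \<kappa>"
  shows "norm (prox_point h \<kappa> c - prox_point h \<kappa> d) \<le> \<kappa> / (\<kappa> - \<rho>) * norm (c - d)"
proof -
  define p q where "p = prox_point h \<kappa> c" and "q = prox_point h \<kappa> d"
  obtain a b where a: "h p = ereal a" and b: "h q = ereal b"
    using prox_point_finite[OF assms(1)] unfolding p_def q_def by metis
  have "a + \<kappa> / 2 * (norm (p - c))\<^sup>2 + (\<kappa> - \<rho>) / 2 * (norm (q - p))\<^sup>2 \<le> b + \<kappa> / 2 * (norm (q - c))\<^sup>2"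
    using prox_point_strong_minimal[OF assms(1), of c a q b] a b by (simp add: p_def)
  moreover have "b + \<kappa> / 2 * (norm (q - d))\<^sup>2 + (\<kappa> - \<rho>) / 2 * (norm (p - q))\<^sup>2 \<le> a + \<kappa> / 2 * (norm (p - d))\<^sup>2"
    using prox_point_strong_minimal[OF assms(1), of d b p a] a b by (simp add: q_def)
  ultimately have "(\<kappa> - \<rho>) * (norm (p - q))\<^sup>2
      \<le> \<kappa> / 2 * ((norm (q - c))\<^sup>2 + (norm (p - d))\<^sup>2 - (norm (p - c))\<^sup>2 - (norm (q - d))\<^sup>2)"
    by (simp add: norm_minus_commute[of q p] field_simps)
  also have "\<dots> = \<kappa> * inner (p - q) (c - d)"
    by (simp add: power2_norm_eq_inner inner_commute algebra_simps)
  also have "\<dots> \<le> \<kappa> * (norm (p - q) * norm (c - d))"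
    using assms(1) by (intro mult_left_mono norm_cauchy_schwarz) auto
  finally have "norm (p - q) * ((\<kappa> - \<rho>) * norm (p - q)) \<le> norm (p - q) * (\<kappa> * norm (c - d))"
    by (simp add: power2_eq_square algebra_simps)
  then have "(\<kappa> - \<rho>) * norm (p - q) \<le> \<kappa> * norm (c - d)"
    using assms(1) by (cases "p = q") auto
  then show ?thesis
    using assms unfolding p_def q_def by (simp add: field_simps)
qed

lemma borel_measurable_prox_point [measurable]:
  assumes "0 < \<kappa>" "\<rho> < \<kappa>"
  shows "prox_point h \<kappa> \<in> borel_measurable borel"
proof (rule borel_measurable_continuous_onI, rule lipschitz_on_continuous_on)
  show "(\<kappa> / (\<kappa> - \<rho>))-lipschitz_on UNIV (prox_point h \<kappa>)"
    using prox_point_lipschitz[OF assms] assms by (auto simp: lipschitz_on_def dist_norm)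
qed

text \<open>Divided by \<open>norm (y - x)\<close>, the quadratic error becomes
  \<open>C * norm (y - x)\<close> and vanishes in the limit, so a global quadratic minorant
  certifies a Frechet subgradient.\<close>

lemma frechet_subdiffI:
  assumes x: "h x = ereal a"
    and le: "\<And>y b. h y \<le> ereal b \<Longrightarrow> a + inner v (y - x) - C * (norm (y - x))\<^sup>2 \<le> b"
  shows "v \<in> frechet_subdiff h x"
proof -
  have "((\<lambda>y. ereal (- (C * norm (y - x)))) \<longlongrightarrow> ereal (- (C * norm (x - x)))) (at x)"
    by (intro tendsto_intros)
  then have "0 = Liminf (at x) (\<lambda>y. ereal (- (C * norm (y - x))))"
    using lim_imp_Liminf[OF at_neq_bot, of _ "ereal (- (C * norm (x - x)))" x] by (simp add: zero_ereal_def)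
  also have "\<dots> \<le> Liminf (at x) (\<lambda>y. (h y - h x - ereal (inner v (y - x))) / ereal (norm (y - x)))"
  proof (rule Liminf_mono)
    have "ereal (- (C * norm (y - x))) \<le> (h y - h x - ereal (inner v (y - x))) / ereal (norm (y - x))"
      if "y \<noteq> x" for y
    proof (cases "h y")
      case (real b)
      have "- (C * norm (y - x)) * norm (y - x) \<le> b - a - inner v (y - x)"
        using le[of y b] real by (simp add: power2_eq_square)
      then have "- (C * norm (y - x)) \<le> (b - a - inner v (y - x)) / norm (y - x)"
        using that by (simp add: pos_le_divide_eq)
      then show ?thesis using real x that by simp
    qed (use x that in \<open>auto simp: ereal_divide\<close>)
    then show "\<forall>\<^sub>F y in at x. ereal (- (C * norm (y - x)))
        \<le> (h y - h x - ereal (inner v (y - x))) / ereal (norm (y - x))"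
      by (auto simp: eventually_at_filter)
  qed
  finally show ?thesis using x by (simp add: frechet_subdiff_def)
qed

text \<open>For a weakly convex function the local condition that defines a Frechet subgradient holds
  globally, up to the quadratic term.\<close>

lemma frechet_subdiffD:
  assumes v: "v \<in> frechet_subdiff h x" and x: "h x = ereal a" and y: "h y \<le> ereal b"
  shows "a + inner v (y - x) - \<rho> / 2 * (norm (y - x))\<^sup>2 \<le> b"
proof (cases "y = x")
  case True then show ?thesis using x y by simp
next
  case False
  \<comment> \<open>The local condition is tested only along the segment from \<open>x\<close> to
    \<open>y\<close>, where weak convexity bounds \<open>h\<close> from above.\<close>
  define w where "w = (\<lambda>t. (1 - t) *\<^sub>R x + t *\<^sub>R y)"
  have w_diff: "w t - x = t *\<^sub>R (y - x)" for t
    unfolding w_def by (simp add: algebra_simps)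
  have w_lim: "filterlim w (at x) (at_right 0)"
    unfolding filterlim_at
  proof
    show "(w \<longlongrightarrow> x) (at_right 0)"
      unfolding w_def by (auto intro!: tendsto_eq_intros)
    have "w t \<noteq> x" if "0 < t" for t
      using w_diff[of t] False that by auto
    then show "\<forall>\<^sub>F t in at_right 0. w t \<in> UNIV \<and> w t \<noteq> x"
      by (auto simp: eventually_at_filter)
  qed
  have liminf: "0 \<le> Liminf (at x) (\<lambda>y. (h y - h x - ereal (inner v (y - x))) / ereal (norm (y - x)))"
    using v by (simp add: frechet_subdiff_def)
  \<comment> \<open>A nonnegative liminf only gives quotients above \<open>- e\<close> for each
    \<open>e > 0\<close>; the perturbation lemma removes this slack.\<close>
  show ?thesis
  proof (rule le_if_le_linear_perturbation[of 1 _ _ "norm (y - x)"])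
    fix e :: real assume "0 < e" "e \<le> 1"
    let ?r = "\<lambda>t. b - a + \<rho> / 2 * ((1 - t) * (norm (y - x))\<^sup>2) - inner v (y - x)"
    have "ereal (- e) < Liminf (at x) (\<lambda>y. (h y - h x - ereal (inner v (y - x))) / ereal (norm (y - x)))"
      by (rule less_le_trans[OF _ liminf]) (use \<open>0 < e\<close> in simp)
    then have "\<forall>\<^sub>F z in at x. ereal (- e) < (h z - h x - ereal (inner v (z - x))) / ereal (norm (z - x))"
      by (rule less_LiminfD)
    then have "\<forall>\<^sub>F t in at_right 0. ereal (- e)
        < (h (w t) - h x - ereal (inner v (w t - x))) / ereal (norm (w t - x))"
      by (rule eventually_compose_filterlim[OF _ w_lim])
    moreover have "\<forall>\<^sub>F t in at_right 0. 0 < t \<and> t < (1::real)"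
      using eventually_at_right_real[of 0 1] by (auto elim: eventually_mono)
    ultimately have "\<forall>\<^sub>F t in at_right 0. - e * norm (y - x) \<le> ?r t"
    proof eventually_elim
      case (elim t)
      then have t: "0 < t" "t < 1" by auto
      have w_le: "h (w t) \<le> ereal ((1 - t) * a + t * b + \<rho> / 2 * (t * (1 - t) * (norm (x - y))\<^sup>2))"
        unfolding w_def using x y t by (intro wconv) auto
      then obtain d where d: "h (w t) = ereal d" by (cases "h (w t)") auto
      have pos: "0 < t * norm (y - x)" using t False by simp
      have "- e < (d - a - t * inner v (y - x)) / (t * norm (y - x))"
        using elim(1) d x t False by (simp add: w_diff)
      then have "- e * (t * norm (y - x)) < d - a - t * inner v (y - x)"
        using pos_less_divide_eq[OF pos] by blast
      also have "\<dots> \<le> t * ?r t"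
        using w_le d by (simp add: norm_minus_commute[of x y] algebra_simps)
      finally have "t * (- e * norm (y - x)) < t * ?r t" by (simp add: algebra_simps)
      then show ?case using mult_less_cancel_left_pos[OF t(1)] by (meson less_imp_le)
    qed
    moreover have "(?r \<longlongrightarrow> ?r 0) (at_right 0)"
      by (intro tendsto_intros)
    ultimately have "- e * norm (y - x) \<le> ?r 0"
      by (intro tendsto_lowerbound[of ?r]) auto
    then show "a + inner v (y - x) - \<rho> / 2 * (norm (y - x))\<^sup>2 \<le> b + e * norm (y - x)"
      by simp
  qed simp
qed

text \<open>First-order optimality: expanding \<open>(norm (y - c))\<^sup>2\<close> around the
  proximal point turns quadratic growth into a minorant with slope
  \<open>\<kappa> *\<^sub>R (c - p)\<close> and quadratic error \<open>\<rho> / 2\<close>.\<close>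

lemma prox_point_subgradient:
  assumes "0 < \<kappa>"
  shows "\<kappa> *\<^sub>R (c - prox_point h \<kappa> c) \<in> frechet_subdiff h (prox_point h \<kappa> c)"
proof -
  define p where "p = prox_point h \<kappa> c"
  obtain b where b: "h p = ereal b" using prox_point_finite[OF assms] unfolding p_def by metis
  show ?thesis unfolding p_def[symmetric]
  proof (rule frechet_subdiffI[where C = "\<rho> / 2", OF b])
    fix y a assume "h y \<le> ereal a"
    then have "b + \<kappa> / 2 * (norm (p - c))\<^sup>2 + (\<kappa> - \<rho>) / 2 * (norm (y - p))\<^sup>2 \<le> a + \<kappa> / 2 * (norm (y - c))\<^sup>2"
      using prox_point_strong_minimal[OF assms] b unfolding p_def by blast
    moreover have "(norm (y - c))\<^sup>2 = (norm (y - p))\<^sup>2 + (norm (p - c))\<^sup>2 - 2 * inner (c - p) (y - p)"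
      by (simp add: power2_norm_eq_inner inner_commute algebra_simps)
    ultimately show "b + inner (\<kappa> *\<^sub>R (c - p)) (y - p) - \<rho> / 2 * (norm (y - p))\<^sup>2 \<le> a"
      by (simp only: inner_scaleR_left) (simp add: field_simps)
  qed
qed

lemma subdiff_dist_prox_point_le:
  assumes "0 < \<kappa>"
  shows "subdiff_dist h (prox_point h \<kappa> c) \<le> ennreal (\<kappa> * norm (c - prox_point h \<kappa> c))"
proof -
  have "subdiff_dist h (prox_point h \<kappa> c) \<le> ennreal (norm (\<kappa> *\<^sub>R (c - prox_point h \<kappa> c)))"
    unfolding subdiff_dist_def by (rule INF_lower[OF prox_point_subgradient[OF assms]])
  then show ?thesis using assms by simp
qed

text \<open>The distance to the subdifferential is lower semicontinuous, because the graph of the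
  subdifferential is closed.\<close>

lemma borel_measurable_subdiff_dist [measurable]: "subdiff_dist h \<in> borel_measurable borel"
proof (rule borel_measurableI_le)
  fix d :: ennreal
  show "{x \<in> space borel. subdiff_dist h x \<le> d} \<in> sets borel"
  proof (cases d)
    case (real d')
    have "closed {x. subdiff_dist h x \<le> d}"
      unfolding closed_sequential_limits
    proof safe
      fix xs x assume "\<forall>n. xs n \<in> {x. subdiff_dist h x \<le> d}" and xs: "xs \<longlonglongrightarrow> x"
      \<comment> \<open>Allowing the norms to exceed \<open>d'\<close> by less than
        \<open>1 / real (Suc n)\<close> avoids any question of attainment. The chosen subgradients
        lie in one ball, so a subsequence converges.\<close>
      have "\<exists>v\<in>frechet_subdiff h (xs n). norm v < d' + 1 / real (Suc n)" for n
      proof -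
        have "subdiff_dist h (xs n) \<le> ennreal d'"
          using \<open>\<forall>n. _\<close> real by auto
        also have "\<dots> < ennreal (d' + 1 / real (Suc n))"
          using real(1) by (intro ennreal_lessI) (auto intro: add_nonneg_pos)
        finally show ?thesis
          unfolding subdiff_dist_def INF_less_iff by (auto simp: ennreal_less_iff)
      qed
      then obtain vs where vs: "\<And>n. vs n \<in> frechet_subdiff h (xs n)"
        and norm_vs: "\<And>n. norm (vs n) < d' + 1 / real (Suc n)"
        by metis
      have "vs n \<in> cball 0 (d' + 1)" for n
      proof -
        have "1 / real (Suc n) \<le> 1" by simp
        with norm_vs[of n] have "norm (vs n) \<le> d' + 1" by linarith
        then show ?thesis by simp
      qed
      then obtain v q where q: "strict_mono q" and v: "(vs \<circ> q) \<longlonglongrightarrow> v"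
        using compact_cball[of 0] unfolding compact_def by metis
      have xq: "(xs \<circ> q) \<longlonglongrightarrow> x" using xs q by (rule LIMSEQ_subseq_LIMSEQ)
      \<comment> \<open>The global subgradient inequality is read as an upper bound on
        \<open>h\<close> at \<open>xs (q n)\<close>. In this form lower semicontinuity carries it to
        the limit.\<close>
      have h_x: "h x \<le> ereal (b - inner v (y - x) + \<rho> / 2 * (norm (y - x))\<^sup>2)" if "h y \<le> ereal b" for y b
      proof (rule lsc[OF xq])
        show "(\<lambda>n. b - inner ((vs \<circ> q) n) (y - (xs \<circ> q) n) + \<rho> / 2 * (norm (y - (xs \<circ> q) n))\<^sup>2)
            \<longlonglongrightarrow> b - inner v (y - x) + \<rho> / 2 * (norm (y - x))\<^sup>2"
          by (intro tendsto_intros v xq)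
        fix n
        have "\<bar>h (xs (q n))\<bar> \<noteq> \<infinity>" using vs[of "q n"] by (simp add: frechet_subdiff_def)
        then obtain a where a: "h (xs (q n)) = ereal a" by auto
        from frechet_subdiffD[OF vs a that]
        show "h ((xs \<circ> q) n)
            \<le> ereal (b - inner ((vs \<circ> q) n) (y - (xs \<circ> q) n) + \<rho> / 2 * (norm (y - (xs \<circ> q) n))\<^sup>2)"
          using a by simp
      qed
      \<comment> \<open>A point of finite value taken as \<open>y\<close> shows that
        \<open>h x\<close> is finite, as a Frechet subgradient requires.\<close>
      obtain z m where "h z = ereal m" using attains_min by blast
      then have "h x < \<infinity>" using h_x[of z m] by (cases "h x") auto
      then obtain a where a: "h x = ereal a" by (rule finite_value)
      have "v \<in> frechet_subdiff h x"
        using h_x unfolding a by (intro frechet_subdiffI[where C = "\<rho> / 2", OF a]) fastforce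
      then have "subdiff_dist h x \<le> ennreal (norm v)"
        unfolding subdiff_dist_def by (rule INF_lower)
      also have "norm v \<le> d' + 0"
      proof (rule LIMSEQ_le[OF tendsto_norm[OF v]])
        show "(\<lambda>n. d' + 1 / real (Suc (q n))) \<longlonglongrightarrow> d' + 0"
          using LIMSEQ_subseq_LIMSEQ[OF LIMSEQ_inverse_real_of_nat q]
          by (intro tendsto_intros) (simp add: o_def inverse_eq_divide)
      qed (use norm_vs in \<open>auto intro: less_imp_le\<close>)
      finally show "subdiff_dist h x \<le> d" using real by (simp add: ennreal_leI)
    qed
    then show ?thesis by simp
  qed simp
qed

end

section \<open>Uniform limits, perturbed proximal points and composite functions\<close>

text \<open>Upper bounds on \<open>h\<close> pass to every \<open>g \<eta>\<close>, the properties
  of \<open>g \<eta>\<close> give a bound independent of \<eta>, and this returns to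
  \<open>h\<close> with an error \<open>R * \<eta>\<close> that vanishes.\<close>

lemma weakly_convex_lsc_uniform_limit:
  fixes h :: "'a::euclidean_space \<Rightarrow> ereal"
  assumes "0 < \<theta>"
    and g: "\<And>\<eta>. \<lbrakk>0 < \<eta>; \<eta> \<le> \<theta>\<rbrakk> \<Longrightarrow> weakly_convex_lsc (g \<eta>) \<rho>"
    and g_le: "\<And>\<eta> x. \<lbrakk>0 < \<eta>; \<eta> \<le> \<theta>\<rbrakk> \<Longrightarrow> g \<eta> x \<le> h x"
    and le_g: "\<And>\<eta> x. \<lbrakk>0 < \<eta>; \<eta> \<le> \<theta>\<rbrakk> \<Longrightarrow> h x \<le> g \<eta> x + ereal (R * \<eta>)"
    and min: "\<exists>z m. h z = ereal m \<and> (\<forall>y. ereal m \<le> h y)"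
  shows "weakly_convex_lsc h \<rho>"
proof -
  have limit: "h w \<le> ereal e" if g_w: "\<And>\<eta>. \<lbrakk>0 < \<eta>; \<eta> \<le> \<theta>\<rbrakk> \<Longrightarrow> g \<eta> w \<le> ereal e" for w e
  proof -
    have *: "h w \<le> ereal (e + \<eta> * R)" if "0 < \<eta>" "\<eta> \<le> \<theta>" for \<eta>
    proof -
      have "h w \<le> g \<eta> w + ereal (R * \<eta>)" using le_g that .
      also have "\<dots> \<le> ereal e + ereal (R * \<eta>)" using g_w that by (intro add_right_mono)
      finally show ?thesis by (simp add: mult.commute)
    qed
    show ?thesis
    proof (cases "h w")
      case (real d)
      have "d \<le> e"
        using \<open>0 < \<theta>\<close> * real by (intro le_if_le_linear_perturbation[of \<theta> d e R]) auto
      then show ?thesis using real by simp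
    next
      case PInf
      then show ?thesis using *[of \<theta>] \<open>0 < \<theta>\<close> by simp
    qed simp
  qed
  show ?thesis
  proof
    fix x y a b and t :: real
    assume "h x \<le> ereal a" "h y \<le> ereal b" "0 \<le> t" "t \<le> 1"
    then show "h ((1 - t) *\<^sub>R x + t *\<^sub>R y)
        \<le> ereal ((1 - t) * a + t * b + \<rho> / 2 * (t * (1 - t) * (norm (x - y))\<^sup>2))"
      by (intro limit weakly_convex_lsc.wconv[OF g]) (auto intro: order_trans[OF g_le])
  next
    fix xs :: "nat \<Rightarrow> 'a" and x as a
    assume lims: "xs \<longlonglongrightarrow> x" "as \<longlonglongrightarrow> a" and le: "\<And>n. h (xs n) \<le> ereal (as n)"
    show "h x \<le> ereal a"
      by (rule limit, rule weakly_convex_lsc.lsc[OF g lims])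
        (auto intro: order_trans[OF g_le le])
  qed (rule min)
qed

text \<open>Each proximal point is a competitor in the other subproblem. Adding the two quadratic
  growth inequalities cancels the distances to \<open>c\<close>, and the values up to
  \<delta>.\<close>

lemma prox_point_perturbation:
  assumes g: "weakly_convex_lsc g \<rho>" and h: "weakly_convex_lsc h \<rho>"
    and le: "\<And>x. g x \<le> h x" "\<And>x. h x \<le> g x + ereal \<delta>"
    and "0 < \<kappa>"
  shows "(\<kappa> - \<rho>) * (norm (prox_point h \<kappa> c - prox_point g \<kappa> c))\<^sup>2 \<le> \<delta>"
proof -
  define p q where "p = prox_point h \<kappa> c" and "q = prox_point g \<kappa> c"
  obtain a where a: "h p = ereal a"
    using weakly_convex_lsc.prox_point_finite[OF h \<open>0 < \<kappa>\<close>] unfolding p_def by metis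
  obtain b where b: "g q = ereal b"
    using weakly_convex_lsc.prox_point_finite[OF g \<open>0 < \<kappa>\<close>] unfolding q_def by metis
  have "b + \<kappa> / 2 * (norm (q - c))\<^sup>2 + (\<kappa> - \<rho>) / 2 * (norm (p - q))\<^sup>2 \<le> a + \<kappa> / 2 * (norm (p - c))\<^sup>2"
    using weakly_convex_lsc.prox_point_strong_minimal[OF g \<open>0 < \<kappa>\<close>, of c b p a] b le(1)[of p] a
    by (simp add: q_def)
  moreover have "a + \<kappa> / 2 * (norm (p - c))\<^sup>2 + (\<kappa> - \<rho>) / 2 * (norm (q - p))\<^sup>2
      \<le> b + \<delta> + \<kappa> / 2 * (norm (q - c))\<^sup>2"
    using weakly_convex_lsc.prox_point_strong_minimal[OF h \<open>0 < \<kappa>\<close>, of c a q "b + \<delta>"] a le(2)[of q] b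
    by (simp add: p_def)
  ultimately show ?thesis
    unfolding p_def[symmetric] q_def[symmetric] by (simp add: norm_minus_commute[of q p] field_simps)
qed

lemma minimizer_composite_finite:
  assumes "proper_fun r" "minimizer (composite f r) z"
  obtains m where "composite f r z = ereal m" "\<And>y. ereal m \<le> composite f r y"
proof -
  obtain y where y: "r y \<noteq> \<infinity>"
    using assms(1) by (auto simp: proper_fun_def domain_of_def)
  have "composite f r z \<le> composite f r y"
    using assms(2) by (simp add: minimizer_def)
  moreover have "composite f r y \<noteq> \<infinity>"
    using y by (cases "r y") (auto simp: composite_def)
  ultimately have "composite f r z \<noteq> \<infinity>" by auto
  moreover have "composite f r z \<noteq> -\<infinity>"
    using assms(1) by (cases "r z") (auto simp: proper_fun_def composite_def)
  ultimately obtain m where "composite f r z = ereal m" by (cases "composite f r z") auto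
  with assms(2) that[of m] show ?thesis by (simp add: minimizer_def)
qed

lemma weakly_convex_lsc_composite:
  fixes f :: "'a::euclidean_space \<Rightarrow> real"
  assumes f: "weakly_convex \<rho> f" "continuous_on UNIV f"
    and r: "proper_fun r" "convex_ereal r" "lower_semicontinuous r"
    and min: "\<exists>z. minimizer (composite f r) z"
  shows "weakly_convex_lsc (composite f r) \<rho>"
proof
  have le_iff: "composite f r x \<le> ereal a \<longleftrightarrow> r x \<le> ereal (a - f x)" for x a
    unfolding composite_def by (cases "r x") auto
  {
    fix x y a b and t :: real
    assume x: "composite f r x \<le> ereal a" and y: "composite f r y \<le> ereal b" and t: "0 \<le> t" "t \<le> 1"
    define w where "w = (1 - t) *\<^sub>R x + t *\<^sub>R y"
    have "f w + \<rho> / 2 * (norm w)\<^sup>2 \<le> (1 - t) * (f x + \<rho> / 2 * (norm x)\<^sup>2) + t * (f y + \<rho> / 2 * (norm y)\<^sup>2)"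
      using f(1) t unfolding weakly_convex_def w_def by (intro convex_onD) auto
    also have "\<dots> = (1 - t) * f x + t * f y + \<rho> / 2 * ((1 - t) * (norm x)\<^sup>2 + t * (norm y)\<^sup>2)"
      by (simp add: field_simps)
    finally have f_w: "f w \<le> (1 - t) * f x + t * f y + \<rho> / 2 * (t * (1 - t) * (norm (x - y))\<^sup>2)"
      unfolding w_def norm_sq_convex_combination by (simp add: algebra_simps)
    have "r w \<le> ereal (1 - t) * r x + ereal t * r y"
      using r(2) t by (simp add: convex_ereal_def w_def)
    also have "\<dots> \<le> ereal (1 - t) * ereal (a - f x) + ereal t * ereal (b - f y)"
      using x y t unfolding le_iff by (intro add_mono ereal_mult_left_mono) auto
    finally have "r w \<le> ereal ((1 - t) * (a - f x) + t * (b - f y))" by simp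
    also have "\<dots> \<le> ereal ((1 - t) * a + t * b + \<rho> / 2 * (t * (1 - t) * (norm (x - y))\<^sup>2) - f w)"
      using f_w by (simp add: algebra_simps)
    finally show "composite f r ((1 - t) *\<^sub>R x + t *\<^sub>R y)
        \<le> ereal ((1 - t) * a + t * b + \<rho> / 2 * (t * (1 - t) * (norm (x - y))\<^sup>2))"
      unfolding le_iff w_def .
  next
    fix xs :: "nat \<Rightarrow> 'a" and x as a
    assume xs: "xs \<longlonglongrightarrow> x" and as: "as \<longlonglongrightarrow> a" and le: "\<And>n. composite f r (xs n) \<le> ereal (as n)"
    have lim: "(\<lambda>n. as n - f (xs n)) \<longlonglongrightarrow> a - f x"
      using f(2) xs as by (intro tendsto_diff) (auto simp: continuous_on_def intro: tendsto_compose)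
    show "composite f r x \<le> ereal a"
      unfolding le_iff
    proof (rule ccontr)
      assume "\<not> r x \<le> ereal (a - f x)"
      then obtain b where b: "ereal (a - f x) < ereal b" "ereal b < r x"
        using ereal_dense2[of "ereal (a - f x)" "r x"] unfolding not_le by blast
      have "ereal b < Liminf (at x) r"
        using b(2) r(3) unfolding lower_semicontinuous_def by (metis less_le_trans)
      then have "\<forall>\<^sub>F y in at x. ereal b < r y" by (rule less_LiminfD)
      \<comment> \<open>\<open>Liminf (at x)\<close> ignores \<open>x\<close> itself, but a sequence
        may visit its limit. Since \<open>b\<close> also lies below \<open>r x\<close>, the
        neighbourhood can be completed.\<close>
      then have "\<forall>\<^sub>F y in nhds x. ereal b < r y"
        unfolding eventually_at_filter by eventually_elim (use b(2) in auto)
      then have "\<forall>\<^sub>F n in sequentially. ereal b < r (xs n)"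
        by (rule eventually_compose_filterlim[OF _ xs])
      moreover have "\<forall>\<^sub>F n in sequentially. as n - f (xs n) < b"
        using b(1) by (intro order_tendstoD(2)[OF lim]) simp
      ultimately have "\<forall>\<^sub>F n in sequentially. False"
      proof eventually_elim
        case (elim n)
        have "ereal b < ereal (as n - f (xs n))"
          using elim(1) le[of n] unfolding le_iff by (rule less_le_trans)
        then show False using elim(2) by simp
      qed
      then show False by simp
    qed
  }
  obtain z where "minimizer (composite f r) z" using min by blast
  then show "\<exists>z m. composite f r z = ereal m \<and> (\<forall>y. ereal m \<le> composite f r y)"
    by (rule minimizer_composite_finite[OF r(1)]) blast
qed

section \<open>Gap and descent inequalities for one proximal step\<close>

context weakly_convex_lsc
begin

text \<open>Turns an optimality gap into a squared distance to the proximal point. For infinite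
  \<open>h z\<close> the gap is infinite.\<close>

lemma prox_gap_ge:
  assumes "0 < \<kappa>"
  shows "ennreal ((\<kappa> - \<rho>) / 2 * (norm (z - prox_point h \<kappa> c))\<^sup>2)
    \<le> e2ennreal (prox_objective h \<kappa> c z - prox_objective h \<kappa> c (prox_point h \<kappa> c))"
proof -
  obtain b where b: "h (prox_point h \<kappa> c) = ereal b" using prox_point_finite[OF assms] .
  show ?thesis
  proof (cases "h z")
    case (real a)
    then show ?thesis
      using prox_point_strong_minimal[OF assms b, of z a] b
      by (simp add: prox_objective_def ennreal_leI)
  next
    case PInf
    then show ?thesis using b by (simp add: prox_objective_def)
  qed simp
qed

text \<open>Quadratic growth with \<open>c\<close> itself as competitor. It supplies the finiteness
  that permits cancellation in \<open>ennreal\<close> when the expected descent is derived.\<close>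

lemma prox_displacement_le:
  assumes "0 < \<kappa>" and m: "\<And>y. ereal m \<le> h y"
  shows "ennreal ((\<kappa> - \<rho>) / 2 * (norm (c - prox_point h \<kappa> c))\<^sup>2) \<le> e2ennreal (h c - ereal m)"
proof -
  obtain b where b: "h (prox_point h \<kappa> c) = ereal b" using prox_point_finite[OF assms(1)] .
  show ?thesis
  proof (cases "h c")
    case (real a)
    have "m \<le> b" using m[of "prox_point h \<kappa> c"] b by simp
    moreover have "0 \<le> \<kappa> / 2 * (norm (prox_point h \<kappa> c - c))\<^sup>2" using assms(1) by simp
    ultimately show ?thesis
      using prox_point_strong_minimal[OF assms(1) b, of c a] real by (simp add: ennreal_leI)
  qed auto
qed

text \<open>Pathwise descent: the objective at \<open>z\<close> exceeds its minimum by the gap, and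
  the minimum lies below \<open>h c\<close> by quadratic growth; the penalty at \<open>z\<close> is
  dropped. The additive form over \<open>ennreal\<close>, with \<open>m\<close> subtracted, admits
  infinite values.\<close>

lemma prox_descent:
  assumes "0 < \<kappa>" "\<rho> \<le> \<kappa>" and m: "\<And>y. ereal m \<le> h y"
  shows "e2ennreal (h z - ereal m) + ennreal ((\<kappa> - \<rho>) / 2 * (norm (c - prox_point h \<kappa> c))\<^sup>2)
    \<le> e2ennreal (prox_objective h \<kappa> c z - prox_objective h \<kappa> c (prox_point h \<kappa> c))
      + e2ennreal (h c - ereal m)"
proof -
  obtain b where b: "h (prox_point h \<kappa> c) = ereal b" using prox_point_finite[OF assms(1)] .
  consider "h z = \<infinity>" | "h c = \<infinity>" | d a where "h z = ereal d" "h c = ereal a"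
    by (cases "h z"; cases "h c") auto
  then show ?thesis
  proof cases
    case 3
    have "m \<le> d" "m \<le> a" using m[of z] m[of c] 3 by auto
    have "0 \<le> (\<kappa> - \<rho>) / 2 * (norm (z - prox_point h \<kappa> c))\<^sup>2" using assms(2) by simp
    then have gap: "b + \<kappa> / 2 * (norm (prox_point h \<kappa> c - c))\<^sup>2 \<le> d + \<kappa> / 2 * (norm (z - c))\<^sup>2"
      using prox_point_strong_minimal[OF assms(1) b, of z d] 3 by simp
    have "b + \<kappa> / 2 * (norm (prox_point h \<kappa> c - c))\<^sup>2 + (\<kappa> - \<rho>) / 2 * (norm (c - prox_point h \<kappa> c))\<^sup>2 \<le> a"
      using prox_point_strong_minimal[OF assms(1) b, of c a] 3 by simp
    moreover have "0 \<le> \<kappa> / 2 * (norm (z - c))\<^sup>2" using assms(1) by simp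
    ultimately have "(d - m) + (\<kappa> - \<rho>) / 2 * (norm (c - prox_point h \<kappa> c))\<^sup>2
        \<le> (d + \<kappa> / 2 * (norm (z - c))\<^sup>2 - (b + \<kappa> / 2 * (norm (prox_point h \<kappa> c - c))\<^sup>2)) + (a - m)"
      by linarith
    then show ?thesis
      using 3 b gap \<open>m \<le> d\<close> \<open>m \<le> a\<close> assms(2)
      by (simp add: prox_objective_def ennreal_leI flip: ennreal_plus)
  qed (use b in \<open>auto simp: prox_objective_def\<close>)
qed

lemma borel_measurable_prox_gap:
  assumes "0 < \<kappa>" "\<rho> < \<kappa>" and [measurable]: "y \<in> borel_measurable M" "c \<in> borel_measurable M"
  shows "(\<lambda>\<omega>. e2ennreal (prox_objective h \<kappa> (c \<omega>) (y \<omega>)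
      - prox_objective h \<kappa> (c \<omega>) (prox_point h \<kappa> (c \<omega>)))) \<in> borel_measurable M"
proof -
  note [measurable] = borel_measurable_prox_point[OF assms(1,2)]
  show ?thesis unfolding prox_objective_def by measurable
qed

end

section \<open>From the conditional guarantee to an expected gap\<close>

lemma subalgebra_history:
  assumes "\<And>i. x i \<in> borel_measurable M"
  shows "subalgebra M (history M x k)"
proof -
  have "(\<lambda>\<omega>. \<lambda>i\<in>{1..<k}. x i \<omega>) \<in> measurable M (\<Pi>\<^sub>M i\<in>{1..<k}. borel)"
    using assms by measurable
  then show ?thesis
    by (simp add: subalgebra_def history_def measurable_iff_sets)
qed

text \<open>Integrating the guarantee removes the conditioning; \<alpha> and \<beta> are slots for
  simpler bounds on its two coefficients.\<close>

lemma (in weakly_convex_lsc) nn_integral_prox_gap_le: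
  assumes "prob_space M" and [measurable]: "\<And>i. x i \<in> borel_measurable M"
    and \<kappa>: "0 < \<kappa>" "\<rho> < \<kappa>" and "0 \<le> L\<^sub>\<eta>"
    and guarantee: "subroutine_guarantee M h \<kappa> \<rho> L\<^sub>\<eta> \<sigma> x k T"
    and \<alpha>: "2 * (L\<^sub>\<eta> + \<kappa>) / (real T * (real T + 1)) \<le> \<alpha>"
    and \<beta>: "4 * \<sigma>\<^sup>2 / ((\<kappa> - \<rho>) * (real T + 1)) \<le> \<beta>"
  shows "(\<integral>\<^sup>+\<omega>. e2ennreal (prox_objective h \<kappa> (x (k - 1) \<omega>) (x k \<omega>)
        - prox_objective h \<kappa> (x (k - 1) \<omega>) (prox_point h \<kappa> (x (k - 1) \<omega>))) \<partial>M)
    \<le> ennreal \<alpha> * (\<integral>\<^sup>+\<omega>. ennreal ((norm (x (k - 1) \<omega> - prox_point h \<kappa> (x (k - 1) \<omega>)))\<^sup>2) \<partial>M) + ennreal \<beta>"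
    (is "(\<integral>\<^sup>+\<omega>. ?gap \<omega> \<partial>M) \<le> _ * (\<integral>\<^sup>+\<omega>. ennreal (?d \<omega>) \<partial>M) + _")
proof -
  interpret prob_space M by fact
  interpret finite_measure_subalgebra M "history M x k"
    by unfold_locales (intro subalgebra_history assms)
  note [measurable] = borel_measurable_prox_point[OF \<kappa>]
  have gap [measurable]: "?gap \<in> borel_measurable M"
    by (intro borel_measurable_prox_gap \<kappa>) measurable
  have "0 \<le> 2 * (L\<^sub>\<eta> + \<kappa>) / (real T * (real T + 1))"
    using \<open>0 \<le> L\<^sub>\<eta>\<close> \<kappa>(1) by simp
  with \<alpha> have "0 \<le> \<alpha>" by linarith
  have "0 \<le> 4 * \<sigma>\<^sup>2 / ((\<kappa> - \<rho>) * (real T + 1))" using \<kappa> by simp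
  with \<beta> have "0 \<le> \<beta>" by linarith
  \<comment> \<open>Tower property, with constant weight 1.\<close>
  have "(\<integral>\<^sup>+\<omega>. ?gap \<omega> \<partial>M) = (\<integral>\<^sup>+\<omega>. nn_cond_exp M (history M x k) ?gap \<omega> \<partial>M)"
    using nn_cond_exp_intg[OF _ gap, of "\<lambda>_. 1"] by simp
  also have "\<dots> \<le> (\<integral>\<^sup>+\<omega>. ennreal (\<alpha> * ?d \<omega> + \<beta>) \<partial>M)"
  proof (rule nn_integral_mono_AE)
    show "AE \<omega> in M. nn_cond_exp M (history M x k) ?gap \<omega> \<le> ennreal (\<alpha> * ?d \<omega> + \<beta>)"
      using guarantee unfolding subroutine_guarantee_def Let_def
    proof eventually_elim
      case (elim \<omega>)
      show ?case
        by (rule order_trans[OF elim], intro ennreal_leI add_mono mult_right_mono \<alpha> \<beta>) simp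
    qed
  qed
  also have "\<dots> = (\<integral>\<^sup>+\<omega>. ennreal \<alpha> * ennreal (?d \<omega>) + ennreal \<beta> \<partial>M)"
    using \<open>0 \<le> \<alpha>\<close> \<open>0 \<le> \<beta>\<close> by (simp add: ennreal_plus ennreal_mult)
  also have "\<dots> = ennreal \<alpha> * (\<integral>\<^sup>+\<omega>. ennreal (?d \<omega>) \<partial>M) + ennreal \<beta>"
    by (simp add: nn_integral_add nn_integral_cmult emeasure_space_1)
  finally show ?thesis .
qed

section \<open>Expected descent\<close>

text \<open>A weighted arithmetic-geometric mean inequality in place of Jensen: for \<open>s\<close>
  of the order of the square root of \<open>b\<close> it loses only a constant factor and needs no
  root.\<close>

lemma (in prob_space) nn_integral_norm_le_second_moment:
  fixes f :: "'a \<Rightarrow> 'b::real_normed_vector"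
  assumes [measurable]: "f \<in> borel_measurable M"
    and le: "(\<integral>\<^sup>+\<omega>. ennreal ((norm (f \<omega>))\<^sup>2) \<partial>M) \<le> ennreal b" and "0 \<le> b" "0 < s"
  shows "(\<integral>\<^sup>+\<omega>. ennreal (norm (f \<omega>)) \<partial>M) \<le> ennreal ((b / s + s) / 2)"
proof -
  have amgm: "norm y \<le> 1 / (2 * s) * (norm y)\<^sup>2 + s / 2" for y :: 'b
  proof -
    have "0 \<le> (norm y - s)\<^sup>2" by simp
    then have "2 * s * norm y \<le> (norm y)\<^sup>2 + s\<^sup>2" by (simp add: power2_diff algebra_simps)
    then show ?thesis using \<open>0 < s\<close> by (simp add: field_simps power2_eq_square)
  qed
  have "(\<integral>\<^sup>+\<omega>. ennreal (norm (f \<omega>)) \<partial>M)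
      \<le> (\<integral>\<^sup>+\<omega>. ennreal (1 / (2 * s)) * ennreal ((norm (f \<omega>))\<^sup>2) + ennreal (s / 2) \<partial>M)"
    using \<open>0 < s\<close> amgm
    by (intro nn_integral_mono) (simp add: ennreal_leI flip: ennreal_mult ennreal_plus)
  also have "\<dots> = ennreal (1 / (2 * s)) * (\<integral>\<^sup>+\<omega>. ennreal ((norm (f \<omega>))\<^sup>2) \<partial>M) + ennreal (s / 2)"
    by (simp add: nn_integral_add nn_integral_cmult emeasure_space_1)
  also have "\<dots> \<le> ennreal (1 / (2 * s)) * ennreal b + ennreal (s / 2)"
    by (intro add_right_mono mult_left_mono le) simp
  also have "\<dots> = ennreal ((b / s + s) / 2)"
    using \<open>0 < s\<close> \<open>0 \<le> b\<close> by (simp add: field_simps flip: ennreal_mult ennreal_plus)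
  finally show ?thesis .
qed

context weakly_convex_lsc
begin

text \<open>The witness is the proximal point of \<open>h\<close> at \<open>c\<close>, measurable
  because \<open>prox_point\<close> is Lipschitz. The map \<open>q\<close> stands for the proximal
  point of a nearby function, from which the distances of \<open>z\<close> and \<open>c\<close> are
  controlled; the former bounds the distance to the witness, the latter its subgradient.\<close>

lemma approx_stationary_in_expectation_prox_point:
  assumes "prob_space M"
    and [measurable]: "c \<in> borel_measurable M" "q \<in> borel_measurable M" "z \<in> borel_measurable M"
    and \<kappa>: "0 < \<kappa>" "\<rho> < \<kappa>"
    and q: "\<And>\<omega>. \<omega> \<in> space M \<Longrightarrow> norm (prox_point h \<kappa> (c \<omega>) - q \<omega>) \<le> e"
    and z: "(\<integral>\<^sup>+\<omega>. ennreal (norm (z \<omega> - q \<omega>)) \<partial>M) \<le> ennreal a"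
    and c: "(\<integral>\<^sup>+\<omega>. ennreal (norm (c \<omega> - q \<omega>)) \<partial>M) \<le> ennreal b"
    and nonneg: "0 \<le> a" "0 \<le> b" "0 \<le> e"
    and \<delta>: "a + e \<le> \<delta>" "\<kappa> * (b + e) \<le> \<delta>"
  shows "approx_stationary_in_expectation M h \<delta> z"
proof -
  interpret prob_space M by fact
  note [measurable] = borel_measurable_prox_point[OF \<kappa>]
  define p where "p = (\<lambda>\<omega>. prox_point h \<kappa> (c \<omega>))"
  have p [measurable]: "p \<in> borel_measurable M" unfolding p_def by measurable
  have tri: "(\<integral>\<^sup>+\<omega>. ennreal (norm (y \<omega> - p \<omega>)) \<partial>M) \<le> ennreal (d + e)"
    if [measurable]: "y \<in> borel_measurable M"
      and y: "(\<integral>\<^sup>+\<omega>. ennreal (norm (y \<omega> - q \<omega>)) \<partial>M) \<le> ennreal d" and "0 \<le> d" for y d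
  proof -
    have "(\<integral>\<^sup>+\<omega>. ennreal (norm (y \<omega> - p \<omega>)) \<partial>M) \<le> (\<integral>\<^sup>+\<omega>. ennreal (norm (y \<omega> - q \<omega>)) + ennreal e \<partial>M)"
    proof (rule nn_integral_mono)
      fix \<omega> assume "\<omega> \<in> space M"
      then have "norm (y \<omega> - p \<omega>) \<le> norm (y \<omega> - q \<omega>) + e"
        using norm_triangle_ineq4[of "y \<omega> - q \<omega>" "p \<omega> - q \<omega>"] q[of \<omega>] by (simp add: p_def)
      then show "ennreal (norm (y \<omega> - p \<omega>)) \<le> ennreal (norm (y \<omega> - q \<omega>)) + ennreal e"
        using nonneg(3) by (simp add: ennreal_leI flip: ennreal_plus)
    qed
    also have "\<dots> \<le> ennreal d + ennreal e"
      by (simp add: nn_integral_add emeasure_space_1 add_right_mono y)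
    finally show ?thesis using \<open>0 \<le> d\<close> nonneg(3) by simp
  qed
  show ?thesis
    unfolding approx_stationary_in_expectation_def
  proof (rule bexI[OF _ p], intro conjI ballI)
    show "p \<omega> \<in> domain_of h" for \<omega>
      by (rule prox_point_finite[OF \<kappa>(1), of "c \<omega>"]) (simp add: domain_of_def p_def)
    show "(\<integral>\<^sup>+\<omega>. ennreal (norm (p \<omega> - z \<omega>)) \<partial>M) \<le> ennreal \<delta>"
      using order_trans[OF tri[OF _ z nonneg(1)] ennreal_leI[OF \<delta>(1)]] by (simp add: norm_minus_commute)
    show "(\<lambda>\<omega>. subdiff_dist h (p \<omega>)) \<in> borel_measurable M" by measurable
    have "(\<integral>\<^sup>+\<omega>. subdiff_dist h (p \<omega>) \<partial>M) \<le> (\<integral>\<^sup>+\<omega>. ennreal \<kappa> * ennreal (norm (c \<omega> - p \<omega>)) \<partial>M)"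
      using subdiff_dist_prox_point_le[OF \<kappa>(1)] \<kappa>(1)
      by (intro nn_integral_mono) (simp add: p_def flip: ennreal_mult)
    also have "\<dots> \<le> ennreal \<kappa> * ennreal (b + e)"
      using tri[OF _ c nonneg(2)] by (simp add: nn_integral_cmult mult_left_mono)
    also have "\<dots> = ennreal (\<kappa> * (b + e))"
      using \<kappa>(1) nonneg by (intro ennreal_mult[symmetric]) auto
    also have "\<dots> \<le> ennreal \<delta>" by (rule ennreal_leI[OF \<delta>(2)])
    finally show "(\<integral>\<^sup>+\<omega>. subdiff_dist h (p \<omega>) \<partial>M) \<le> ennreal \<delta>" .
  qed
qed

text \<open>The gap bound absorbs half of the decrease that an exact proximal step would give.\<close>

lemma expected_descent:
  assumes "prob_space M" and [measurable]: "\<And>i. x i \<in> borel_measurable M"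
    and \<kappa>: "0 < \<kappa>" "\<rho> < \<kappa>" and m: "\<And>y. ereal m \<le> h y" and "0 \<le> \<beta>"
    and gap: "\<And>k. 1 \<le> k \<Longrightarrow> (\<integral>\<^sup>+\<omega>. e2ennreal (prox_objective h \<kappa> (x (k - 1) \<omega>) (x k \<omega>)
          - prox_objective h \<kappa> (x (k - 1) \<omega>) (prox_point h \<kappa> (x (k - 1) \<omega>))) \<partial>M)
        \<le> ennreal ((\<kappa> - \<rho>) / 4)
          * (\<integral>\<^sup>+\<omega>. ennreal ((norm (x (k - 1) \<omega> - prox_point h \<kappa> (x (k - 1) \<omega>)))\<^sup>2) \<partial>M) + ennreal \<beta>"
    and start: "(\<integral>\<^sup>+\<omega>. e2ennreal (h (x 0 \<omega>) - ereal m) \<partial>M) \<le> ennreal u" "0 \<le> u"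
  shows "(\<integral>\<^sup>+\<omega>. e2ennreal (h (x K \<omega>) - ereal m) \<partial>M)
      + (\<Sum>k=1..K. ennreal ((\<kappa> - \<rho>) / 4)
          * (\<integral>\<^sup>+\<omega>. ennreal ((norm (x (k - 1) \<omega> - prox_point h \<kappa> (x (k - 1) \<omega>)))\<^sup>2) \<partial>M))
    \<le> ennreal (u + real K * \<beta>)"
proof (induction K)
  case 0
  then show ?case using start by simp
next
  case (Suc K)
  interpret prob_space M by fact
  note [measurable] = borel_measurable_prox_point[OF \<kappa>]
  define p where "p = (\<lambda>\<omega>. prox_point h \<kappa> (x K \<omega>))"
  define U where "U = (\<lambda>k. \<integral>\<^sup>+\<omega>. e2ennreal (h (x k \<omega>) - ereal m) \<partial>M)"
  define D where "D = (\<integral>\<^sup>+\<omega>. ennreal ((norm (x K \<omega> - p \<omega>))\<^sup>2) \<partial>M)"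
  define S where "S = (\<Sum>k=1..K. ennreal ((\<kappa> - \<rho>) / 4)
      * (\<integral>\<^sup>+\<omega>. ennreal ((norm (x (k - 1) \<omega> - prox_point h \<kappa> (x (k - 1) \<omega>)))\<^sup>2) \<partial>M))"
  let ?gap = "\<lambda>\<omega>. e2ennreal (prox_objective h \<kappa> (x K \<omega>) (x (Suc K) \<omega>) - prox_objective h \<kappa> (x K \<omega>) (p \<omega>))"
  have p [measurable]: "p \<in> borel_measurable M" unfolding p_def by measurable
  have gap_meas [measurable]: "?gap \<in> borel_measurable M"
    unfolding p_def by (intro borel_measurable_prox_gap \<kappa>) measurable
  have half_D: "ennreal ((\<kappa> - \<rho>) / 2) * D = (\<integral>\<^sup>+\<omega>. ennreal ((\<kappa> - \<rho>) / 2 * (norm (x K \<omega> - p \<omega>))\<^sup>2) \<partial>M)"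
  proof -
    have "(\<integral>\<^sup>+\<omega>. ennreal ((\<kappa> - \<rho>) / 2 * (norm (x K \<omega> - p \<omega>))\<^sup>2) \<partial>M)
        = (\<integral>\<^sup>+\<omega>. ennreal ((\<kappa> - \<rho>) / 2) * ennreal ((norm (x K \<omega> - p \<omega>))\<^sup>2) \<partial>M)"
      using \<kappa> by (intro nn_integral_cong ennreal_mult) auto
    then show ?thesis unfolding D_def by (simp add: nn_integral_cmult)
  qed
  \<comment> \<open>This makes the multiple of \<open>D\<close> to be cancelled below finite;
    \<open>ennreal\<close> addition does not cancel \<open>top\<close>.\<close>
  have "ennreal ((\<kappa> - \<rho>) / 2) * D \<le> U K"
    unfolding half_D U_def p_def by (intro nn_integral_mono prox_displacement_le \<kappa> m)
  also have "U K \<le> U K + S" by simp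
  also have "\<dots> \<le> ennreal (u + real K * \<beta>)" using Suc.IH unfolding U_def S_def .
  also have "\<dots> < top" by simp
  finally have quarter_D: "ennreal ((\<kappa> - \<rho>) / 4) * D \<noteq> top"
    using \<kappa> by (auto simp: ennreal_mult_eq_top_iff ennreal_mult_less_top)
  \<comment> \<open>Of the two quarters, one cancels against the gap bound and the other remains as
    progress.\<close>
  have "ennreal ((\<kappa> - \<rho>) / 2) = ennreal ((\<kappa> - \<rho>) / 4) + ennreal ((\<kappa> - \<rho>) / 4)"
    using \<kappa> by (subst ennreal_plus[symmetric]) auto
  then have split_D: "ennreal ((\<kappa> - \<rho>) / 2) * D = ennreal ((\<kappa> - \<rho>) / 4) * D + ennreal ((\<kappa> - \<rho>) / 4) * D"
    by (simp only: distrib_right)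
  have "U (Suc K) + ennreal ((\<kappa> - \<rho>) / 2) * D
      = (\<integral>\<^sup>+\<omega>. e2ennreal (h (x (Suc K) \<omega>) - ereal m) + ennreal ((\<kappa> - \<rho>) / 2 * (norm (x K \<omega> - p \<omega>))\<^sup>2) \<partial>M)"
    unfolding half_D U_def by (simp add: nn_integral_add)
  also have "\<dots> \<le> (\<integral>\<^sup>+\<omega>. ?gap \<omega> + e2ennreal (h (x K \<omega>) - ereal m) \<partial>M)"
    using \<kappa> unfolding p_def by (intro nn_integral_mono prox_descent m) auto
  also have "\<dots> = (\<integral>\<^sup>+\<omega>. ?gap \<omega> \<partial>M) + U K"
    unfolding U_def by (simp add: nn_integral_add)
  also have "\<dots> \<le> (ennreal ((\<kappa> - \<rho>) / 4) * D + ennreal \<beta>) + U K"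
    using gap[of "Suc K"] unfolding D_def p_def by (intro add_right_mono) simp
  finally have "ennreal ((\<kappa> - \<rho>) / 4) * D + (U (Suc K) + ennreal ((\<kappa> - \<rho>) / 4) * D)
      \<le> ennreal ((\<kappa> - \<rho>) / 4) * D + (U K + ennreal \<beta>)"
    unfolding split_D by (simp only: ac_simps)
  then have "U (Suc K) + ennreal ((\<kappa> - \<rho>) / 4) * D \<le> U K + ennreal \<beta>"
    using quarter_D by (simp add: ennreal_add_left_cancel_le)
  then have "U (Suc K) + (S + ennreal ((\<kappa> - \<rho>) / 4) * D) \<le> (U K + S) + ennreal \<beta>"
    using add_right_mono[of _ _ S] by (simp add: ac_simps)
  also have "\<dots> \<le> ennreal (u + real K * \<beta>) + ennreal \<beta>"
    using Suc.IH unfolding U_def S_def by (rule add_right_mono)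
  also have "\<dots> = ennreal (u + real (Suc K) * \<beta>)"
    using \<open>0 \<le> \<beta>\<close> \<open>0 \<le> u\<close> by (simp add: algebra_simps flip: ennreal_plus)
  finally show ?case unfolding U_def S_def D_def p_def by simp
qed

text \<open>Averaging: were all \<open>K\<close> displacements above \<open>d\<close>, their sum
  would exceed the total that the descent allows. The strict inequality, with \<open>u\<close>
  nonnegative, rules out \<open>K = 0\<close>.\<close>

lemma ex_small_expected_displacement:
  assumes "prob_space M" "\<And>i. x i \<in> borel_measurable M"
    and \<kappa>: "0 < \<kappa>" "\<rho> < \<kappa>" and "\<And>y. ereal m \<le> h y" "0 \<le> \<beta>"
    and "\<And>k. 1 \<le> k \<Longrightarrow> (\<integral>\<^sup>+\<omega>. e2ennreal (prox_objective h \<kappa> (x (k - 1) \<omega>) (x k \<omega>)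
          - prox_objective h \<kappa> (x (k - 1) \<omega>) (prox_point h \<kappa> (x (k - 1) \<omega>))) \<partial>M)
        \<le> ennreal ((\<kappa> - \<rho>) / 4)
          * (\<integral>\<^sup>+\<omega>. ennreal ((norm (x (k - 1) \<omega> - prox_point h \<kappa> (x (k - 1) \<omega>)))\<^sup>2) \<partial>M) + ennreal \<beta>"
    and "(\<integral>\<^sup>+\<omega>. e2ennreal (h (x 0 \<omega>) - ereal m) \<partial>M) \<le> ennreal u" "0 \<le> u"
    and d: "u + real K * \<beta> < real K * ((\<kappa> - \<rho>) / 4 * d)" "0 \<le> d"
  shows "\<exists>k\<in>{1..K}. (\<integral>\<^sup>+\<omega>. ennreal ((norm (x (k - 1) \<omega> - prox_point h \<kappa> (x (k - 1) \<omega>)))\<^sup>2) \<partial>M) \<le> ennreal d"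
proof (rule ccontr)
  let ?D = "\<lambda>k. \<integral>\<^sup>+\<omega>. ennreal ((norm (x (k - 1) \<omega> - prox_point h \<kappa> (x (k - 1) \<omega>)))\<^sup>2) \<partial>M"
  assume "\<not> ?thesis"
  then have D: "\<And>k. k \<in> {1..K} \<Longrightarrow> ennreal d \<le> ?D k" by force
  have "ennreal (real K * ((\<kappa> - \<rho>) / 4 * d)) = (\<Sum>k=1..K. ennreal ((\<kappa> - \<rho>) / 4) * ennreal d)"
    using \<kappa> d(2) by (simp add: ennreal_of_nat_eq_real_of_nat flip: ennreal_mult)
  also have "\<dots> \<le> (\<Sum>k=1..K. ennreal ((\<kappa> - \<rho>) / 4) * ?D k)"
    by (intro sum_mono mult_left_mono D) auto
  also have "\<dots> \<le> (\<integral>\<^sup>+\<omega>. e2ennreal (h (x K \<omega>) - ereal m) \<partial>M) + (\<Sum>k=1..K. ennreal ((\<kappa> - \<rho>) / 4) * ?D k)"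
    by simp
  also have "\<dots> \<le> ennreal (u + real K * \<beta>)"
    by (rule expected_descent) fact+
  finally have "real K * ((\<kappa> - \<rho>) / 4 * d) \<le> u + real K * \<beta>"
    using \<open>0 \<le> u\<close> \<open>0 \<le> \<beta>\<close> by (subst (asm) ennreal_le_iff) auto
  with d(1) show False by simp
qed

end

section \<open>Approximate stationarity of the starting point and of some iterate\<close>

text \<open>Covers runs of zero outer iterations: an exact proximal step from \<open>x0\<close>
  cannot decrease \<open>h\<close> by more than \<open>a - m\<close>, so it has length at most
  \<epsilon> / \<rho>.\<close>

lemma approx_stationary_initial_point:
  fixes x :: "'w \<Rightarrow> 'a::euclidean_space"
  assumes h: "weakly_convex_lsc h \<rho>" and "prob_space M" and "0 < \<rho>" "0 \<le> \<epsilon>"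
    and x: "x \<in> borel_measurable M" "\<And>\<omega>. \<omega> \<in> space M \<Longrightarrow> x \<omega> = x0"
    and m: "\<And>y. ereal m \<le> h y" and x0: "h x0 = ereal a" and small: "\<rho> * (a - m) \<le> \<epsilon>\<^sup>2"
    and \<delta>: "\<epsilon> / \<rho> \<le> \<delta>" "2 * \<epsilon> \<le> \<delta>"
  shows "approx_stationary_in_expectation M h \<delta> x"
proof -
  interpret prob_space M by fact
  define p where "p = prox_point h (2 * \<rho>) x0"
  obtain b where b: "h p = ereal b"
    by (rule weakly_convex_lsc.prox_point_finite[OF h, of "2 * \<rho>" x0])
      (use \<open>0 < \<rho>\<close> in \<open>auto simp: p_def\<close>)
  have "prox_objective h (2 * \<rho>) x0 p \<le> prox_objective h (2 * \<rho>) x0 x0"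
    using weakly_convex_lsc.prox_point_minimal[OF h] \<open>0 < \<rho>\<close> unfolding p_def by simp
  then have "b + \<rho> * (norm (p - x0))\<^sup>2 \<le> a"
    using b x0 by (simp add: prox_objective_def)
  moreover have "m \<le> b" using m[of p] b by simp
  ultimately have "\<rho> * (norm (p - x0))\<^sup>2 \<le> a - m" by linarith
  then have "\<rho> * (\<rho> * (norm (p - x0))\<^sup>2) \<le> \<epsilon>\<^sup>2"
    using small \<open>0 < \<rho>\<close> mult_left_mono[of _ _ \<rho>] by (meson less_imp_le order_trans)
  then have "(\<rho> * norm (p - x0))\<^sup>2 \<le> \<epsilon>\<^sup>2"
    by (simp add: power2_eq_square ac_simps)
  then have "\<rho> * norm (p - x0) \<le> \<epsilon>"
    using \<open>0 \<le> \<epsilon>\<close> by (rule power2_le_imp_le)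
  then have p: "norm (x0 - p) \<le> \<epsilon> / \<rho>"
    using \<open>0 < \<rho>\<close> by (simp add: field_simps norm_minus_commute)
  have int: "(\<integral>\<^sup>+\<omega>. ennreal (norm (x \<omega> - p)) \<partial>M) \<le> ennreal (\<epsilon> / \<rho>)"
  proof -
    have "(\<integral>\<^sup>+\<omega>. ennreal (norm (x \<omega> - p)) \<partial>M) \<le> (\<integral>\<^sup>+\<omega>. ennreal (\<epsilon> / \<rho>) \<partial>M)"
      using x(2) p by (intro nn_integral_mono ennreal_leI) simp
    then show ?thesis by (simp add: emeasure_space_1)
  qed
  show ?thesis
    using \<open>0 < \<rho>\<close> \<open>0 \<le> \<epsilon>\<close> \<delta> x int
    by (intro weakly_convex_lsc.approx_stationary_in_expectation_prox_point[OF h,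
          where c = x and q = "\<lambda>_. p" and \<kappa> = "2 * \<rho>" and e = 0 and a = "\<epsilon> / \<rho>" and b = "\<epsilon> / \<rho>"])
      (auto simp: p_def prob_space_axioms)
qed

text \<open>With proximal parameter \<open>2 * \<rho>\<close> the subproblems have strong convexity
  modulus \<rho>, so the descent keeps the coefficient \<open>\<rho> / 4\<close>. One index controls
  both the centre \<open>x (k - 1)\<close>, for the subgradient, and the output \<open>x k\<close>,
  for the distance.\<close>

lemma ex_approx_stationary_iterate:
  assumes g: "weakly_convex_lsc g \<rho>" and h: "weakly_convex_lsc h \<rho>"
    and le: "\<And>y. g y \<le> h y" "\<And>y. h y \<le> g y + ereal (R * \<epsilon>\<^sup>2)"
    and pos: "0 < \<rho>" "0 < \<epsilon>" "0 \<le> R" "0 \<le> L\<^sub>\<eta>"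
    and "prob_space M" and [measurable]: "\<And>k. x k \<in> borel_measurable M"
    and x0: "\<And>\<omega>. \<omega> \<in> space M \<Longrightarrow> x 0 \<omega> = x0"
    and guarantee: "\<And>k. 1 \<le> k \<Longrightarrow> subroutine_guarantee M g (2 * \<rho>) \<rho> L\<^sub>\<eta> \<sigma> x k T"
    and T: "2 * (L\<^sub>\<eta> + 2 * \<rho>) / (real T * (real T + 1)) \<le> \<rho> / 4"
      "4 * \<sigma>\<^sup>2 / (\<rho> * (real T + 1)) \<le> \<epsilon>\<^sup>2 / (2 * \<rho>)"
    and m: "\<And>y. ereal m \<le> g y" and a: "g x0 = ereal a"
    and K: "\<rho> * (a - m) < 2 * real K * \<epsilon>\<^sup>2"
    and \<delta>: "(sqrt (R / \<rho>) + 6 / \<rho>) * \<epsilon> \<le> \<delta>" "2 * \<rho> * ((sqrt (R / \<rho>) + 6 / \<rho>) * \<epsilon>) \<le> \<delta>"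
  shows "\<exists>k\<in>{1..K}. approx_stationary_in_expectation M h \<delta> (x k)"
proof -
  interpret prob_space M by fact
  interpret g: weakly_convex_lsc g \<rho> by fact
  interpret h: weakly_convex_lsc h \<rho> by fact
  have \<kappa>: "0 < 2 * \<rho>" "\<rho> < 2 * \<rho>" using pos by auto
  note [measurable] = g.borel_measurable_prox_point[OF \<kappa>]
  define p where "p = (\<lambda>k \<omega>. prox_point g (2 * \<rho>) (x (k - 1) \<omega>))"
  define D where "D = (\<lambda>k. \<integral>\<^sup>+\<omega>. ennreal ((norm (x (k - 1) \<omega> - p k \<omega>))\<^sup>2) \<partial>M)"
  define G where "G = (\<lambda>k \<omega>. e2ennreal (prox_objective g (2 * \<rho>) (x (k - 1) \<omega>) (x k \<omega>)
      - prox_objective g (2 * \<rho>) (x (k - 1) \<omega>) (p k \<omega>)))"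
  have [measurable]: "p k \<in> borel_measurable M" for k unfolding p_def by measurable
  have gap: "(\<integral>\<^sup>+\<omega>. G k \<omega> \<partial>M) \<le> ennreal (\<rho> / 4) * D k + ennreal (\<epsilon>\<^sup>2 / (2 * \<rho>))" if "1 \<le> k" for k
    unfolding G_def D_def p_def
    by (rule g.nn_integral_prox_gap_le[OF \<open>prob_space M\<close> _ \<kappa> pos(4) guarantee[OF that]])
      (use T in auto)
  have "0 \<le> a - m" using m[of x0] a by simp
  have start: "(\<integral>\<^sup>+\<omega>. e2ennreal (g (x 0 \<omega>) - ereal m) \<partial>M) \<le> ennreal (a - m)"
  proof -
    have "(\<integral>\<^sup>+\<omega>. e2ennreal (g (x 0 \<omega>) - ereal m) \<partial>M) = (\<integral>\<^sup>+\<omega>. ennreal (a - m) \<partial>M)"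
      using x0 a by (intro nn_integral_cong) simp
    then show ?thesis by (simp add: emeasure_space_1)
  qed
  \<comment> \<open>The constant 10 splits as 8 + 2: after multiplication by
    \<open>K * \<rho> / 4\<close>, the 8 pays for the initial excess \<open>a - m\<close> and the 2
    for \<open>K\<close> noise terms.\<close>
  have "\<exists>k\<in>{1..K}. D k \<le> ennreal (10 * \<epsilon>\<^sup>2 / \<rho>\<^sup>2)"
    unfolding D_def p_def
  proof (rule g.ex_small_expected_displacement[where x = x and \<beta> = "\<epsilon>\<^sup>2 / (2 * \<rho>)",
        OF \<open>prob_space M\<close> _ \<kappa> m _ _ start \<open>0 \<le> a - m\<close>])
    have "a - m < 2 * real K * \<epsilon>\<^sup>2 / \<rho>"
      using K pos(1) by (simp add: field_simps)
    moreover have "real K * ((2 * \<rho> - \<rho>) / 4 * (10 * \<epsilon>\<^sup>2 / \<rho>\<^sup>2))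
        = 2 * real K * \<epsilon>\<^sup>2 / \<rho> + real K * (\<epsilon>\<^sup>2 / (2 * \<rho>))"
      using pos(1) by (simp add: field_simps power2_eq_square)
    ultimately show "a - m + real K * (\<epsilon>\<^sup>2 / (2 * \<rho>)) < real K * ((2 * \<rho> - \<rho>) / 4 * (10 * \<epsilon>\<^sup>2 / \<rho>\<^sup>2))"
      by linarith
  qed (use gap pos in \<open>auto simp: G_def D_def p_def\<close>)
  then obtain k where k: "k \<in> {1..K}" and D: "D k \<le> ennreal (10 * \<epsilon>\<^sup>2 / \<rho>\<^sup>2)" by blast
  \<comment> \<open>Quadratic growth gives \<open>2 / \<rho>\<close> times the expected gap, and
    that gap is at most \<open>3 * \<epsilon>\<^sup>2 / \<rho>\<close>.\<close>
  have E: "(\<integral>\<^sup>+\<omega>. ennreal ((norm (x k \<omega> - p k \<omega>))\<^sup>2) \<partial>M) \<le> ennreal (6 * \<epsilon>\<^sup>2 / \<rho>\<^sup>2)"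
  proof -
    have "(\<integral>\<^sup>+\<omega>. ennreal ((norm (x k \<omega> - p k \<omega>))\<^sup>2) \<partial>M)
        = (\<integral>\<^sup>+\<omega>. ennreal (2 / \<rho>) * ennreal ((2 * \<rho> - \<rho>) / 2 * (norm (x k \<omega> - p k \<omega>))\<^sup>2) \<partial>M)"
      using pos(1) by (simp flip: ennreal_mult)
    also have "\<dots> = ennreal (2 / \<rho>) * (\<integral>\<^sup>+\<omega>. ennreal ((2 * \<rho> - \<rho>) / 2 * (norm (x k \<omega> - p k \<omega>))\<^sup>2) \<partial>M)"
      by (rule nn_integral_cmult) measurable
    also have "\<dots> \<le> ennreal (2 / \<rho>) * (\<integral>\<^sup>+\<omega>. G k \<omega> \<partial>M)"
      unfolding G_def p_def by (intro mult_left_mono nn_integral_mono g.prox_gap_ge \<kappa>) simp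
    also have "\<dots> \<le> ennreal (2 / \<rho>) * (ennreal (\<rho> / 4) * ennreal (10 * \<epsilon>\<^sup>2 / \<rho>\<^sup>2) + ennreal (\<epsilon>\<^sup>2 / (2 * \<rho>)))"
      using k by (intro mult_left_mono order_trans[OF gap] add_right_mono D) auto
    also have "\<dots> = ennreal (2 / \<rho> * (\<rho> / 4 * (10 * \<epsilon>\<^sup>2 / \<rho>\<^sup>2) + \<epsilon>\<^sup>2 / (2 * \<rho>)))"
      using pos(1) by (simp flip: ennreal_mult ennreal_plus)
    also have "2 / \<rho> * (\<rho> / 4 * (10 * \<epsilon>\<^sup>2 / \<rho>\<^sup>2) + \<epsilon>\<^sup>2 / (2 * \<rho>)) = 6 * \<epsilon>\<^sup>2 / \<rho>\<^sup>2"
      using pos(1) by (simp add: field_simps power2_eq_square)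
    finally show ?thesis .
  qed
  \<comment> \<open>A smoothing error \<open>R * \<epsilon>\<^sup>2\<close> in the values moves the
    proximal point by order \<epsilon>; hence the choice of \<eta> as the square of
    \<epsilon>.\<close>
  have near: "norm (prox_point h (2 * \<rho>) c - prox_point g (2 * \<rho>) c) \<le> sqrt (R / \<rho>) * \<epsilon>" for c
  proof -
    have "\<rho> * (norm (prox_point h (2 * \<rho>) c - prox_point g (2 * \<rho>) c))\<^sup>2 \<le> R * \<epsilon>\<^sup>2"
      using prox_point_perturbation[OF g h le \<kappa>(1), of c] by simp
    then have "(norm (prox_point h (2 * \<rho>) c - prox_point g (2 * \<rho>) c))\<^sup>2 \<le> R / \<rho> * \<epsilon>\<^sup>2"
      using pos(1) by (simp add: field_simps)
    also have "\<dots> = (sqrt (R / \<rho>) * \<epsilon>)\<^sup>2"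
      using pos by (simp add: power_mult_distrib)
    finally show ?thesis
      by (rule power2_le_imp_le) (use pos in simp)
  qed
  let ?e = "sqrt (R / \<rho>) * \<epsilon>"
  \<comment> \<open>With \<open>s = \<epsilon> / \<rho>\<close> the constant is (10 + 1) / 2,
    rounded up to 6.\<close>
  have l1: "(\<integral>\<^sup>+\<omega>. ennreal (norm (y \<omega> - p k \<omega>)) \<partial>M) \<le> ennreal (6 / \<rho> * \<epsilon>)"
    if [measurable]: "y \<in> borel_measurable M"
      and y: "(\<integral>\<^sup>+\<omega>. ennreal ((norm (y \<omega> - p k \<omega>))\<^sup>2) \<partial>M) \<le> ennreal (10 * \<epsilon>\<^sup>2 / \<rho>\<^sup>2)" for y
  proof -
    have "(\<integral>\<^sup>+\<omega>. ennreal (norm (y \<omega> - p k \<omega>)) \<partial>M) \<le> ennreal ((10 * \<epsilon>\<^sup>2 / \<rho>\<^sup>2 / (\<epsilon> / \<rho>) + \<epsilon> / \<rho>) / 2)"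
      using pos by (intro nn_integral_norm_le_second_moment[OF _ y]) auto
    also have "\<dots> \<le> ennreal (6 / \<rho> * \<epsilon>)"
      using pos by (intro ennreal_leI) (simp add: field_simps power2_eq_square)
    finally show ?thesis .
  qed
  have "6 * \<epsilon>\<^sup>2 / \<rho>\<^sup>2 \<le> 10 * \<epsilon>\<^sup>2 / \<rho>\<^sup>2" by (simp add: divide_right_mono)
  then have E': "(\<integral>\<^sup>+\<omega>. ennreal ((norm (x k \<omega> - p k \<omega>))\<^sup>2) \<partial>M) \<le> ennreal (10 * \<epsilon>\<^sup>2 / \<rho>\<^sup>2)"
    using E ennreal_leI order_trans by blast
  have "approx_stationary_in_expectation M h \<delta> (x k)"
  proof (rule h.approx_stationary_in_expectation_prox_point[OF \<open>prob_space M\<close> _ _ _ \<kappa>])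
    show "norm (prox_point h (2 * \<rho>) (x (k - 1) \<omega>) - p k \<omega>) \<le> ?e" for \<omega>
      unfolding p_def by (rule near)
    show "(\<integral>\<^sup>+\<omega>. ennreal (norm (x k \<omega> - p k \<omega>)) \<partial>M) \<le> ennreal (6 / \<rho> * \<epsilon>)"
      by (rule l1[OF _ E']) simp
    show "(\<integral>\<^sup>+\<omega>. ennreal (norm (x (k - 1) \<omega> - p k \<omega>)) \<partial>M) \<le> ennreal (6 / \<rho> * \<epsilon>)"
      using D unfolding D_def by (rule l1[rotated]) simp
    show "6 / \<rho> * \<epsilon> + ?e \<le> \<delta>" "2 * \<rho> * (6 / \<rho> * \<epsilon> + ?e) \<le> \<delta>"
      using \<delta> by (simp_all add: algebra_simps)
  qed (use pos in auto)
  with k show ?thesis by blast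
qed

section \<open>Iteration counts and the complexity bound\<close>

text \<open>\<open>A\<close> stands for \<open>B + L / \<eta> + 2 * \<rho>\<close>. The first entry
  of the maximum makes the square of \<open>T\<close> at least \<open>8 * A / \<rho>\<close>, which
  controls the displacement coefficient; the second controls the noise.\<close>

lemma inner_iterations_bounds:
  fixes A \<rho> \<epsilon> \<sigma> :: real
  assumes "0 < \<rho>" "0 < \<epsilon>" "2 * \<rho> \<le> A"
  defines "T \<equiv> nat \<lceil>max (2 * sqrt (2 * A / \<rho>)) (8 * \<sigma>\<^sup>2 / \<epsilon>\<^sup>2)\<rceil>"
  shows "2 * A / (real T * (real T + 1)) \<le> \<rho> / 4"
    and "4 * \<sigma>\<^sup>2 / (\<rho> * (real T + 1)) \<le> \<epsilon>\<^sup>2 / (2 * \<rho>)"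
    and "real T \<le> 10 * max (sqrt (A / \<rho>)) (\<sigma>\<^sup>2 / \<epsilon>\<^sup>2)"
proof -
  let ?t = "max (2 * sqrt (2 * A / \<rho>)) (8 * \<sigma>\<^sup>2 / \<epsilon>\<^sup>2)"
  have T: "?t \<le> real T" unfolding T_def by (rule real_nat_ceiling_ge)
  \<comment> \<open>This makes \<open>T\<close> positive and the target maximum at least 1, so that
    rounding up can be absorbed.\<close>
  have "2 \<le> A / \<rho>" using assms by (simp add: field_simps)
  then have "0 < sqrt (2 * A / \<rho>)" by simp
  with T have "0 < real T" by linarith
  have "(2 * sqrt (2 * A / \<rho>))\<^sup>2 \<le> (real T)\<^sup>2"
    using T \<open>0 < sqrt _\<close> by (intro power_mono) auto
  then have "8 * (A / \<rho>) \<le> (real T)\<^sup>2"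
    using \<open>2 \<le> A / \<rho>\<close> by (simp add: power_mult_distrib)
  also have "\<dots> \<le> real T * (real T + 1)" by (simp add: power2_eq_square algebra_simps)
  finally have "8 * A \<le> \<rho> * (real T * (real T + 1))"
    using assms(1) by (simp add: field_simps)
  then show "2 * A / (real T * (real T + 1)) \<le> \<rho> / 4"
    using \<open>0 < real T\<close> by (simp add: divide_le_eq)
  have "8 * \<sigma>\<^sup>2 / \<epsilon>\<^sup>2 \<le> real T + 1" using T by linarith
  then have \<sigma>: "8 * \<sigma>\<^sup>2 \<le> \<epsilon>\<^sup>2 * (real T + 1)"
    using assms(2) by (simp add: field_simps)
  show "4 * \<sigma>\<^sup>2 / (\<rho> * (real T + 1)) \<le> \<epsilon>\<^sup>2 / (2 * \<rho>)"
  proof -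
    have "4 * \<sigma>\<^sup>2 / (\<rho> * (real T + 1)) \<le> (\<epsilon>\<^sup>2 * (real T + 1) / 2) / (\<rho> * (real T + 1))"
      using assms(1) \<sigma> by (intro divide_right_mono) auto
    then show ?thesis using \<open>0 < real T\<close> by simp
  qed
  let ?m = "max (sqrt (A / \<rho>)) (\<sigma>\<^sup>2 / \<epsilon>\<^sup>2)"
  have "1 \<le> sqrt (A / \<rho>)" using \<open>2 \<le> A / \<rho>\<close> by (intro real_le_rsqrt) simp
  have "sqrt 2 \<le> 2" by (rule real_le_lsqrt) auto
  then have "2 * sqrt (2 * A / \<rho>) \<le> 4 * sqrt (A / \<rho>)"
    using \<open>1 \<le> sqrt (A / \<rho>)\<close> mult_right_mono[of "sqrt 2" 2 "sqrt (A / \<rho>)"]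
    by (simp add: real_sqrt_mult flip: times_divide_eq_right)
  moreover have "sqrt (A / \<rho>) \<le> ?m" "\<sigma>\<^sup>2 / \<epsilon>\<^sup>2 \<le> ?m" by simp_all
  moreover have "8 * \<sigma>\<^sup>2 / \<epsilon>\<^sup>2 = 8 * (\<sigma>\<^sup>2 / \<epsilon>\<^sup>2)" by simp
  \<comment> \<open>The factor 8 plus at most 1 for rounding stays within 10, because
    \<open>?m\<close> is at least 1.\<close>
  ultimately have "?t \<le> 8 * ?m"
    using \<open>1 \<le> sqrt (A / \<rho>)\<close> by (intro max.boundedI) linarith+
  moreover have "real T \<le> ?t + 1"
  proof -
    have "0 \<le> ?t" using \<open>0 < sqrt _\<close> by (simp add: le_max_iff_disj)
    then show ?thesis
      unfolding T_def using of_int_ceiling_le_add_one[of ?t] by simp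
  qed
  ultimately show "real T \<le> 10 * ?m"
    using \<open>1 \<le> sqrt (A / \<rho>)\<close> \<open>sqrt (A / \<rho>) \<le> ?m\<close> by linarith
qed

theorem theorem5p4:
  fixes P :: "'s measure"
    and F :: "'a::euclidean_space \<Rightarrow> 's \<Rightarrow> real"
    and r :: "'a \<Rightarrow> ereal"
    and X :: "'a set"
    and F\<^sub>s :: "real \<Rightarrow> 'a \<Rightarrow> 's \<Rightarrow> real"
    and \<theta> \<rho> R B L \<sigma> :: real
    and x0 xstar :: 'a
  assumes "smoothed_problem P F r X F\<^sub>s \<theta> \<rho> R B L \<sigma>"
    and "x0 \<in> domain_of r"
    and "minimizer (composite (mean_fun P F) r) xstar"
  shows "\<exists>c>0. \<forall>\<epsilon>::real. 0 < \<epsilon> \<and> \<epsilon>\<^sup>2 \<le> \<theta> \<longrightarrow>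
    (let \<phi> = composite (mean_fun P F) r;
         \<eta> = \<epsilon>\<^sup>2;
         T = (\<lambda>k::nat. nat \<lceil>max (2 * sqrt (2 * (B + L / \<eta> + 2 * \<rho>) / \<rho>)) (8 * \<sigma>\<^sup>2 / \<epsilon>\<^sup>2)\<rceil>)
     in \<exists>K::nat.
       real (\<Sum>k=1..K. T k)
         \<le> 10 * (\<rho> * (real_of_ereal (\<phi> x0) - real_of_ereal (\<phi> xstar) + R * \<eta>) / \<epsilon>\<^sup>2
                 * max (sqrt ((B + L / \<epsilon>\<^sup>2 + 2 * \<rho>) / \<rho>)) (\<sigma>\<^sup>2 / \<epsilon>\<^sup>2)) \<and>
       (\<forall>(M :: 'w measure) \<xi> query out x.
          asgd_sipp_run P r F\<^sub>s \<eta> (2 * \<rho>) \<rho> B L \<sigma> T x0 M \<xi> query out x \<longrightarrow>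
          (\<exists>k \<in> (if K = 0 then {0} else {1..K}).
             approx_stationary_in_expectation M \<phi> (c * \<epsilon>) (x k))))"
proof -
  interpret smoothed_problem P F r X F\<^sub>s \<theta> \<rho> R B L \<sigma> by fact
  let ?\<phi> = "composite (mean_fun P F) r"
  let ?\<phi>s = "\<lambda>\<eta>. composite (mean_fun P (F\<^sub>s \<eta>)) r"
  have smoothed: "weakly_convex_lsc (?\<phi>s \<eta>) \<rho>" if "0 < \<eta>" "\<eta> \<le> \<theta>" for \<eta>
  proof (rule weakly_convex_lsc_composite[OF fs_weakly_convex[OF that] _ r_proper r_convex r_lsc
        smoothed_minimizer_exists[OF that]])
    show "continuous_on UNIV (mean_fun P (F\<^sub>s \<eta>))"
      using fs_differentiable[OF that]
      by (auto intro!: continuous_at_imp_continuous_on differentiable_imp_continuous_within)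
  qed
  \<comment> \<open>The comparison of \<open>f\<close> with its smoothing is available on
    \<open>X\<close>, which contains the domain of \<open>r\<close>; off that domain both composites
    are infinite.\<close>
  have smoothed_le: "?\<phi>s \<eta> y \<le> ?\<phi> y" if "0 < \<eta>" "\<eta> \<le> \<theta>" for \<eta> y
  proof (cases "y \<in> domain_of r")
    case True
    then have "mean_fun P (F\<^sub>s \<eta>) y \<le> mean_fun P F y" using fs_le_f[OF that] dom_r_subset_X by auto
    then show ?thesis unfolding composite_def by (intro add_right_mono) simp
  next
    case False
    then show ?thesis by (simp add: domain_of_def composite_def)
  qed
  have le_smoothed: "?\<phi> y \<le> ?\<phi>s \<eta> y + ereal (R * \<eta>)" if "0 < \<eta>" "\<eta> \<le> \<theta>" for \<eta> y
  proof (cases "y \<in> domain_of r")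
    case True
    then have "mean_fun P F y \<le> mean_fun P (F\<^sub>s \<eta>) y + R * \<eta>" using f_le_fs[OF that] dom_r_subset_X by auto
    then show ?thesis unfolding composite_def by (cases "r y") auto
  next
    case False
    then show ?thesis by (simp add: domain_of_def composite_def)
  qed
  obtain m where m: "?\<phi> xstar = ereal m" and m_le: "\<And>y. ereal m \<le> ?\<phi> y"
    using minimizer_composite_finite[OF r_proper assms(3)] by blast
  have original: "weakly_convex_lsc ?\<phi> \<rho>"
    using m m_le
    by (intro weakly_convex_lsc_uniform_limit[where g = ?\<phi>s, OF constants(1) smoothed smoothed_le le_smoothed]) auto
  obtain a where a: "?\<phi> x0 = ereal a"
    using assms(2) weakly_convex_lsc.finite_value[OF original, of x0]
    by (auto simp: domain_of_def composite_def)
  \<comment> \<open>\<open>c\<close> dominates the distance constant and the subgradient constant,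
    which is \<open>2 * \<rho>\<close> times it. It depends on \<rho> and \<open>R\<close> only,
    hence serves all \<epsilon>.\<close>
  define c where "c = (2 * \<rho> + 1) * (sqrt (R / \<rho>) + 6 / \<rho>)"
  have s_nonneg: "0 \<le> sqrt (R / \<rho>)" using constants by simp
  have "0 < sqrt (R / \<rho>) + 6 / \<rho>" using constants s_nonneg by (intro add_nonneg_pos) auto
  moreover from this have "0 < 2 * \<rho> * (sqrt (R / \<rho>) + 6 / \<rho>)" using constants(2) by simp
  moreover have "c = 2 * \<rho> * (sqrt (R / \<rho>) + 6 / \<rho>) + (sqrt (R / \<rho>) + 6 / \<rho>)"
    by (simp add: c_def distrib_right)
  ultimately have c: "0 < c" "sqrt (R / \<rho>) + 6 / \<rho> \<le> c" "2 * \<rho> * (sqrt (R / \<rho>) + 6 / \<rho>) \<le> c"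
    by linarith+
  \<comment> \<open>Distance and subgradient constants for the case of zero outer
    iterations.\<close>
  have c0: "1 / \<rho> \<le> c" "2 \<le> c"
  proof -
    have "1 / \<rho> \<le> 6 / \<rho>" using constants(2) by (simp add: divide_right_mono)
    then show "1 / \<rho> \<le> c" using c(2) s_nonneg by linarith
    have "2 \<le> 2 * \<rho> * (6 / \<rho>)" using constants(2) by simp
    also have "\<dots> \<le> 2 * \<rho> * (sqrt (R / \<rho>) + 6 / \<rho>)"
      using constants(2) s_nonneg by (intro mult_left_mono) auto
    finally show "2 \<le> c" using c(3) by linarith
  qed
  show ?thesis
  proof (intro exI[of _ c] conjI allI impI c(1))
    fix \<epsilon> :: real assume "0 < \<epsilon> \<and> \<epsilon>\<^sup>2 \<le> \<theta>"
    then have "0 < \<epsilon>" and \<eta>: "0 < \<epsilon>\<^sup>2" "\<epsilon>\<^sup>2 \<le> \<theta>" by auto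
    define T where "T = nat \<lceil>max (2 * sqrt (2 * (B + L / \<epsilon>\<^sup>2 + 2 * \<rho>) / \<rho>)) (8 * \<sigma>\<^sup>2 / \<epsilon>\<^sup>2)\<rceil>"
    define \<Delta> where "\<Delta> = a - m + R * \<epsilon>\<^sup>2"
    \<comment> \<open>The floor keeps the cost within the claimed product with no additive term. A
      quotient below 1 gives \<open>K = 0\<close>, where \<open>x0\<close> itself qualifies.\<close>
    define K where "K = nat \<lfloor>\<rho> * \<Delta> / \<epsilon>\<^sup>2\<rfloor>"
    have L\<^sub>\<eta>: "0 \<le> B + L / \<epsilon>\<^sup>2" using constants by simp
    then have "2 * \<rho> \<le> B + L / \<epsilon>\<^sup>2 + 2 * \<rho>" by simp
    note T = inner_iterations_bounds[OF constants(2) \<open>0 < \<epsilon>\<close> this, of \<sigma>, folded T_def]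
    have "m \<le> a" using m_le[of x0] a by simp
    then have "0 \<le> \<Delta>" using constants by (simp add: \<Delta>_def)
    then have q: "0 \<le> \<rho> * \<Delta> / \<epsilon>\<^sup>2" using constants(2) by simp
    have K_le: "real K \<le> \<rho> * \<Delta> / \<epsilon>\<^sup>2" unfolding K_def using q by simp
    have K_gt: "\<rho> * \<Delta> < (real K + 1) * \<epsilon>\<^sup>2"
    proof -
      have "\<rho> * \<Delta> / \<epsilon>\<^sup>2 < real K + 1" unfolding K_def using q by (simp add: floor_less_iff)
      then show ?thesis using \<eta>(1) by (simp add: divide_less_eq)
    qed
    obtain z ms where ms: "?\<phi>s (\<epsilon>\<^sup>2) z = ereal ms" "\<And>y. ereal ms \<le> ?\<phi>s (\<epsilon>\<^sup>2) y"
      using weakly_convex_lsc.attains_min[OF smoothed[OF \<eta>]] by blast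
    obtain as where as: "?\<phi>s (\<epsilon>\<^sup>2) x0 = ereal as"
      using smoothed_le[OF \<eta>, of x0] a ms(2)[of x0] by (cases "?\<phi>s (\<epsilon>\<^sup>2) x0") auto
    \<comment> \<open>Smoothing does not raise the value at \<open>x0\<close> and lowers the minimum
      by at most \<open>R * \<epsilon>\<^sup>2\<close>; this is the source of the term
      \<open>R * \<eta>\<close> in the bound.\<close>
    have "as \<le> a" using smoothed_le[OF \<eta>, of x0] a as by simp
    moreover have "m \<le> ms + R * \<epsilon>\<^sup>2"
      using order_trans[OF m_le[of z] le_smoothed[OF \<eta>, of z]] ms(1) by simp
    ultimately have \<Delta>: "as - ms \<le> \<Delta>" by (simp add: \<Delta>_def)
    have cost: "real (\<Sum>k=1..K. T) \<le> 10 * (\<rho> * \<Delta> / \<epsilon>\<^sup>2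
        * max (sqrt ((B + L / \<epsilon>\<^sup>2 + 2 * \<rho>) / \<rho>)) (\<sigma>\<^sup>2 / \<epsilon>\<^sup>2))"
    proof -
      have "real (\<Sum>k=1..K. T) = real K * real T" by simp
      also have "\<dots> \<le> \<rho> * \<Delta> / \<epsilon>\<^sup>2 * (10 * max (sqrt ((B + L / \<epsilon>\<^sup>2 + 2 * \<rho>) / \<rho>)) (\<sigma>\<^sup>2 / \<epsilon>\<^sup>2))"
        using K_le T(3) q by (intro mult_mono) auto
      finally show ?thesis by (simp only: mult.left_commute[of _ 10])
    qed
    have stationary: "\<exists>k \<in> (if K = 0 then {0} else {1..K}).
        approx_stationary_in_expectation M ?\<phi> (c * \<epsilon>) (x k)"
      if run: "asgd_sipp_run P r F\<^sub>s (\<epsilon>\<^sup>2) (2 * \<rho>) \<rho> B L \<sigma> (\<lambda>_. T) x0 M \<xi> query out x"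
      for M :: "'w measure" and \<xi> query out x
    proof -
      have M: "prob_space M" and x: "\<And>k. x k \<in> borel_measurable M"
        and x_0: "\<And>\<omega>. \<omega> \<in> space M \<Longrightarrow> x 0 \<omega> = x0"
        and guarantee: "\<And>k. 1 \<le> k \<Longrightarrow>
          subroutine_guarantee M (?\<phi>s (\<epsilon>\<^sup>2)) (2 * \<rho>) \<rho> (B + L / \<epsilon>\<^sup>2) \<sigma> x k T"
        using run unfolding asgd_sipp_run_def by blast+
      have "K = 0 \<Longrightarrow> approx_stationary_in_expectation M ?\<phi> (c * \<epsilon>) (x 0)"
      proof (rule approx_stationary_initial_point[OF original M constants(2) _ x x_0 m_le a, where \<epsilon> = \<epsilon>])
        assume "K = 0"
        have "\<rho> * (a - m) \<le> \<rho> * \<Delta>"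
          using constants by (intro mult_left_mono) (auto simp: \<Delta>_def)
        then show "\<rho> * (a - m) \<le> \<epsilon>\<^sup>2" using K_gt \<open>K = 0\<close> by simp
      qed (use \<open>0 < \<epsilon>\<close> c0 mult_right_mono[OF c0(1), of \<epsilon>] in auto)
      moreover have "\<exists>k\<in>{1..K}. approx_stationary_in_expectation M ?\<phi> (c * \<epsilon>) (x k)" if "K \<noteq> 0"
      proof (rule ex_approx_stationary_iterate[OF smoothed[OF \<eta>] original smoothed_le[OF \<eta>]
            le_smoothed[OF \<eta>] constants(2) \<open>0 < \<epsilon>\<close> constants(3) L\<^sub>\<eta> M x x_0 guarantee _ T(2) ms(2) as])
        have "\<rho> * (as - ms) \<le> \<rho> * \<Delta>" using \<Delta> constants(2) by simp
        also have "\<dots> < (real K + 1) * \<epsilon>\<^sup>2" by (rule K_gt)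
        \<comment> \<open>For \<open>K\<close> at least 1, doubling \<open>K\<close> pays for the
          loss in the floor.\<close>
        also have "\<dots> \<le> 2 * real K * \<epsilon>\<^sup>2" using that by (intro mult_right_mono) auto
        finally show "\<rho> * (as - ms) < 2 * real K * \<epsilon>\<^sup>2" .
      qed (use T(1) c \<open>0 < \<epsilon>\<close> mult_right_mono[OF c(3), of \<epsilon>] in \<open>auto simp: mult.assoc\<close>)
      ultimately show ?thesis by (cases "K = 0") auto
    qed
    show "let \<phi> = ?\<phi>; \<eta> = \<epsilon>\<^sup>2;
         T = (\<lambda>k::nat. nat \<lceil>max (2 * sqrt (2 * (B + L / \<eta> + 2 * \<rho>) / \<rho>)) (8 * \<sigma>\<^sup>2 / \<epsilon>\<^sup>2)\<rceil>)
     in \<exists>K::nat.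
       real (\<Sum>k=1..K. T k)
         \<le> 10 * (\<rho> * (real_of_ereal (\<phi> x0) - real_of_ereal (\<phi> xstar) + R * \<eta>) / \<epsilon>\<^sup>2
                 * max (sqrt ((B + L / \<epsilon>\<^sup>2 + 2 * \<rho>) / \<rho>)) (\<sigma>\<^sup>2 / \<epsilon>\<^sup>2)) \<and>
       (\<forall>(M :: 'w measure) \<xi> query out x.
          asgd_sipp_run P r F\<^sub>s \<eta> (2 * \<rho>) \<rho> B L \<sigma> T x0 M \<xi> query out x \<longrightarrow>
          (\<exists>k \<in> (if K = 0 then {0} else {1..K}).
             approx_stationary_in_expectation M \<phi> (c * \<epsilon>) (x k)))"
      unfolding Let_def T_def[symmetric] a m
      using cost stationary unfolding \<Delta>_def by (intro exI[of _ K]) (simp only: real_of_ereal.simps simp_thms, blast)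
  qed
qed

end
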